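(* Let $X$ be a Banach space with a Schauder basis and $k\in\mathbb{N}$. Suppose that $\mathcal{SM}^{wrc}_k(X)$ contains a sequence equivalent to the usual basis of $\ell^1$. Then there exists a plegma block $k$-sequence in $X$ which generates a $k$-spreading model equivalent to the usual basis of $\ell^1$.
   Context: $[M]^k$: $k$-subsets of $M\subseteq\mathbb{N}$ (increasing enumerations, $M(l)$ the $l$-th element). A $k$-sequence in $X$ is a map $[\mathbb{N}]^k\to X$, $s\mapsto x_s$. Plegma family: $(s_j)_{j=1}^l$ in $[M]^k$ with $s_1(i)<\dots<s_l(i)$ ($i\le k$), $s_l(i)<s_1(i+1)$ ($i<k$); plegma pair = plegma family of length 2. $(x_s)_{s\in[M]^k}$ generates the Hamel basis $(e_n)$ of a seminormed space $(E,\|\cdot\|_* )$ as a $k$-spreading model if for a null sequence $\delta_l>0$: $|\|\sum_{j=1}^m a_jx_{s_j}\|-\|\sum_{j=1}^m a_je_j\|_*|\le\delta_l$ for all $m\le l$, plegma $(s_j)_{j=1}^m$ in $[M]^k$ with $s_1(1)\ge M(l)$, $a_j\in[-1,1]$. A $k$-sequence is weakly relatively compact if the weak closure of $\{x_s:s\in[\mathbb{N}]^k\}$ is weakly compact; $\mathcal{SM}^{wrc}_k(X)$ is the set of spreading sequences generated as $k$-spreading models by weakly relatively compact $k$-sequences in $X$. A $k$-sequence $(x_s)$ in $X$ is plegma block if each $x_s$ is finitely supported w.r.t. the basis and $\max\mathrm{supp}(x_{s_1})<\min\mathrm{supp}(x_{s_2})$ for every plegma pair $(s_1,s_2)$ in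 $[\mathbb{N}]^k$. *)

theory Defs
  imports "HOL-Analysis.Analysis" "HOL-Library.Infinite_Set"
begin

definition schauder_basis :: "(nat \<Rightarrow> 'a::real_normed_vector) \<Rightarrow> bool" where
  "schauder_basis b \<longleftrightarrow> (\<forall>x. \<exists>!c::nat \<Rightarrow> real. (\<lambda>n. c n *\<^sub>R b n) sums x)"

definition basis_coeff :: "(nat \<Rightarrow> 'a::real_normed_vector) \<Rightarrow> 'a \<Rightarrow> nat \<Rightarrow> real" where
  "basis_coeff b x = (THE c. (\<lambda>n. c n *\<^sub>R b n) sums x)"

definition basis_supp :: "(nat \<Rightarrow> 'a::real_normed_vector) \<Rightarrow> 'a \<Rightarrow> nat set" where
  "basis_supp b x = {n. basis_coeff b x n \<noteq> 0}"

definition ksubsets :: "nat set \<Rightarrow> nat \<Rightarrow> nat set set" where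
  "ksubsets M k = {s. s \<subseteq> M \<and> finite s \<and> card s = k}"

text \<open>The i-th element (0-indexed) of a finite set s of naturals, i.e. s(i+1) in the paper.\<close>
definition elt :: "nat set \<Rightarrow> nat \<Rightarrow> nat" where
  "elt s i = sorted_list_of_set s ! i"

definition plegma_family :: "nat \<Rightarrow> nat set \<Rightarrow> nat \<Rightarrow> (nat \<Rightarrow> nat set) \<Rightarrow> bool" where
  "plegma_family k M l s \<longleftrightarrow>
     (\<forall>j<l. s j \<in> ksubsets M k) \<and>
     (\<forall>i<k. \<forall>j. j + 1 < l \<longrightarrow> elt (s j) i < elt (s (j + 1)) i) \<and>
     (\<forall>i. i + 1 < k \<longrightarrow> elt (s (l - 1)) i < elt (s 0) (i + 1))"

definition plegma_pair :: "nat \<Rightarrow> nat set \<Rightarrow> nat set \<Rightarrow> nat set \<Rightarrow> bool" where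
  "plegma_pair k M s1 s2 \<longleftrightarrow> plegma_family k M 2 (\<lambda>j. if j = 0 then s1 else s2)"

text \<open>A seminormed space with Hamel basis (e_n) is represented (up to isometry) by the
  space of finitely supported real sequences, e_n being the n-th unit vector, with a
  seminorm p.  Then the seminorm of a_1 e_1 + ... + a_m e_m is p applied to the
  truncation of a to {0..<m}.\<close>
definition fin_supp :: "(nat \<Rightarrow> real) \<Rightarrow> bool" where
  "fin_supp a \<longleftrightarrow> finite {i. a i \<noteq> 0}"

definition fs_seminorm :: "((nat \<Rightarrow> real) \<Rightarrow> real) \<Rightarrow> bool" where
  "fs_seminorm p \<longleftrightarrow>
     (\<forall>a b. fin_supp a \<longrightarrow> fin_supp b \<longrightarrow> p (\<lambda>i. a i + b i) \<le> p a + p b) \<and>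
     (\<forall>a c. fin_supp a \<longrightarrow> p (\<lambda>i. c * a i) = \<bar>c\<bar> * p a)"

definition trunc :: "nat \<Rightarrow> (nat \<Rightarrow> real) \<Rightarrow> nat \<Rightarrow> real" where
  "trunc m a = (\<lambda>i. if i < m then a i else 0)"

definition k_spreading_model ::
  "nat \<Rightarrow> (nat set \<Rightarrow> 'a::real_normed_vector) \<Rightarrow> nat set \<Rightarrow> ((nat \<Rightarrow> real) \<Rightarrow> real) \<Rightarrow> bool" where
  "k_spreading_model k x M p \<longleftrightarrow>
     infinite M \<and> fs_seminorm p \<and>
     (\<exists>\<delta>::nat \<Rightarrow> real. (\<forall>l. \<delta> l > 0) \<and> \<delta> \<longlonglongrightarrow> 0 \<and>
       (\<forall>l m s a. 1 \<le> l \<longrightarrow> 1 \<le> m \<longrightarrow> m \<le> l \<longrightarrow> plegma_family k M m s \<longrightarrow>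
          elt (s 0) 0 \<ge> enumerate M (l - 1) \<longrightarrow> (\<forall>j<m. \<bar>a j\<bar> \<le> 1) \<longrightarrow>
          \<bar>norm (\<Sum>j<m. a j *\<^sub>R x (s j)) - p (trunc m a)\<bar> \<le> \<delta> l))"

definition equiv_l1 :: "((nat \<Rightarrow> real) \<Rightarrow> real) \<Rightarrow> bool" where
  "equiv_l1 p \<longleftrightarrow> (\<exists>c C. c > 0 \<and> (\<forall>m a.
      c * (\<Sum>j<m. \<bar>a j\<bar>) \<le> p (trunc m a) \<and> p (trunc m a) \<le> C * (\<Sum>j<m. \<bar>a j\<bar>)))"

definition weak_top :: "'a::real_normed_vector topology" where
  "weak_top = topology_generated_by
     {{y. blinfun_apply f y \<in> U} | (f :: 'a \<Rightarrow>\<^sub>L real) U. open U}"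

definition weakly_rel_compact :: "'a::real_normed_vector set \<Rightarrow> bool" where
  "weakly_rel_compact A \<longleftrightarrow> compactin weak_top (weak_top closure_of A)"

definition plegma_block ::
  "(nat \<Rightarrow> 'a::real_normed_vector) \<Rightarrow> nat \<Rightarrow> (nat set \<Rightarrow> 'a) \<Rightarrow> bool" where
  "plegma_block b k x \<longleftrightarrow>
     (\<forall>s \<in> ksubsets UNIV k. finite (basis_supp b (x s))) \<and>
     (\<forall>s1 s2. plegma_pair k UNIV s1 s2 \<longrightarrow>
        (\<forall>n \<in> basis_supp b (x s1). \<forall>n' \<in> basis_supp b (x s2). n < n'))"

end

theory Submission
  imports Defs "HOL-Library.Ramsey" "HOL-Real_Asymp.Real_Asymp"
begin

text \<open>
  On a weakly compact set the weak topology is seen by the countably many basis coefficients, so after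
  passing to a subset all iterated limits of \<open>x\<^sub>s\<close> along initial segments of \<open>s\<close> exist in the space.
  Telescoping these limits, and perturbing, writes \<open>x\<^sub>s\<close> as a constant plus \<open>k\<close> components, the \<open>i\<close>-th
  of which lives on an interval determined by the \<open>i\<close>-th element of \<open>s\<close>; hence each of these components
  is plegma block. By Ramsey's theorem every component generates a spreading model, and the sum of the
  resulting seminorms dominates the l1 norm. A seminorm that does not dominate it by itself is small on
  some normalized vector, and is eliminated by passing to the translates of that vector. One component
  survives; it is not the constant one, which vanishes on vectors with coordinate sum zero. The
  corresponding finite linear combinations of that component form the required plegma block sequence.
\<close>

section \<open>Shift-invariant seminorms on finitely supported sequences\<close>

text \<open>The decomposition is forced by the definition of plegma block. The elements of a plegma
  pair alternate, s_1(i) < s_2(i) < s_1(i+1), so parts of the two vectors governed by different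
  levels interlace; only parts belonging to one fixed level i come in block position. A lower l^1
  estimate for a sum of seminorms need not pass to any summand as it stands, which is why
  combinations of a component, and not the component itself, make up the final sequence. Weak
  compactness serves two purposes. It makes the iterated limits vectors of the space, not mere
  coefficient sequences, so the increments have convergent expansions and can be cut off with small
  error in norm. And since the coefficient functionals map weakly compact sets onto compact subsets
  of a metrizable product, it supplies convergent subsequences. Continuity of these functionals has
  to be earned: \<open>schauder_basis\<close> only speaks of unique expansions, and Baire's theorem
  gives the rest.\<close>

definition shift_invariant :: "((nat \<Rightarrow> real) \<Rightarrow> real) \<Rightarrow> bool" where
  "shift_invariant p \<longleftrightarrow>
     (\<forall>a d. fin_supp a \<longrightarrow> p (\<lambda>i. if i < d then 0 else a (i - d)) = p a)"

text \<open>For \<open>m \<ge> 1\<close> this is a Kronecker product: the coefficient sequence of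
  the sum of all b(i) v_i, where v_i is the vector (a(0), ..., a(m-1)) moved to the positions i*m,
  ..., i*m + m - 1. It substitutes disjoint translates of one vector for the unit vectors.\<close>

definition tens :: "nat \<Rightarrow> (nat \<Rightarrow> real) \<Rightarrow> (nat \<Rightarrow> real) \<Rightarrow> nat \<Rightarrow> real" where
  "tens m a b = (\<lambda>n. b (n div m) * a (n mod m))"

lemma fin_supp_trunc [simp]: "fin_supp (trunc m a)"
  unfolding fin_supp_def trunc_def by (rule finite_subset[of _ "{..<m}"]) auto

lemma fin_supp_imp_trunc:
  assumes "fin_supp a"
  obtains m where "trunc m a = a"
proof -
  from assms obtain m where "\<forall>i\<in>{i. a i \<noteq> 0}. i < m"
    unfolding fin_supp_def finite_nat_set_iff_bounded by blast
  hence "trunc m a = a" by (auto simp: trunc_def fun_eq_iff)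
  thus ?thesis by (rule that)
qed

lemma fin_supp_add: "fin_supp a \<Longrightarrow> fin_supp b \<Longrightarrow> fin_supp (\<lambda>i. a i + b i)"
  unfolding fin_supp_def by (rule finite_subset[of _ "{i. a i \<noteq> 0} \<union> {i. b i \<noteq> 0}"]) auto

lemma fin_supp_scale: "fin_supp a \<Longrightarrow> fin_supp (\<lambda>i. c * a i)"
  unfolding fin_supp_def by (rule finite_subset[of _ "{i. a i \<noteq> 0}"]) auto

lemma fin_supp_shift: "fin_supp a \<Longrightarrow> fin_supp (\<lambda>i. if i < d then 0 else a (i - d))"
  unfolding fin_supp_def
  by (rule finite_subset[of _ "(\<lambda>i. i + d) ` {i. a i \<noteq> 0}"])
     (auto simp: image_iff intro!: exI[of _ "_ - d"])

lemma tens_trunc: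
  assumes "m \<ge> 1"
  shows "tens m a (trunc l b) = trunc (l * m) (tens m a b)"
  using assms by (auto simp: tens_def trunc_def fun_eq_iff less_mult_imp_div_less div_less_iff_less_mult)

lemma fin_supp_tens:
  assumes "m \<ge> 1" "fin_supp b"
  shows "fin_supp (tens m a b)"
  using assms by (metis fin_supp_imp_trunc fin_supp_trunc tens_trunc)

lemma tens_one: "tens 1 (\<lambda>_. 1) b = b"
  by (simp add: tens_def)

text \<open>Associativity: blocks of blocks are blocks, so the repeated passages to translates in
  \<open>exists_tens_l1\<close> collapse into a single vector.\<close>

lemma tens_tens: "tens m a (tens m' a' b) = tens (m * m') (tens m a a') b"
proof
  fix n
  have "(n mod (m * m')) div m = (n div m) mod m'"
    by (cases "m = 0") (auto simp: mod_mult2_eq)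
  moreover have "n mod (m * m') mod m = n mod m"
    by (simp add: mod_mult2_eq)
  ultimately show "tens m a (tens m' a' b) n = tens (m * m') (tens m a a') b n"
    by (simp add: tens_def div_mult2_eq)
qed

lemma sum_div_mod:
  fixes f :: "nat \<Rightarrow> nat \<Rightarrow> 'a::comm_monoid_add"
  shows "(\<Sum>n<l * m. f (n div m) (n mod m)) = (\<Sum>i<l. \<Sum>j<m. f i j)"
proof -
  have "(\<Sum>n=i * m..<i * m + m. f (n div m) (n mod m)) = (\<Sum>j<m. f i j)" for i
  proof -
    have "(\<Sum>n=i * m..<i * m + m. f (n div m) (n mod m)) =
        (\<Sum>j=0..<m. f ((j + i * m) div m) ((j + i * m) mod m))"
      using sum.shift_bounds_nat_ivl[of "\<lambda>n. f (n div m) (n mod m)" 0 "i * m" m]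
      by (simp add: add.commute)
    also have "\<dots> = (\<Sum>j<m. f i j)" by (intro sum.cong) auto
    finally show ?thesis .
  qed
  thus ?thesis by (simp add: sum.nat_group[symmetric])
qed

text \<open>The l^1 norm is multiplicative, so a normalized \<open>a\<close> carries an l^1 lower
  bound over to its blocks with the same constant.\<close>

lemma sum_abs_tens:
  "(\<Sum>n<l * m. \<bar>tens m a b n\<bar>) = (\<Sum>i<l. \<bar>b i\<bar>) * (\<Sum>j<m. \<bar>a j\<bar>)"
  using sum_div_mod[of "\<lambda>i j. \<bar>b i\<bar> * \<bar>a j\<bar>" m l]
  by (simp add: tens_def abs_mult sum_product)

lemma sum_tens_scaleR:
  fixes z :: "nat \<Rightarrow> nat \<Rightarrow> 'a::real_vector"
  shows "(\<Sum>n<l * m. tens m a b n *\<^sub>R z (n div m) (n mod m)) =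
    (\<Sum>i<l. b i *\<^sub>R (\<Sum>j<m. a j *\<^sub>R z i j))"
  using sum_div_mod[of "\<lambda>i j. (b i * a j) *\<^sub>R z i j" m l]
  by (simp add: tens_def scaleR_sum_right)

lemma fs_seminorm_zero: "fs_seminorm p \<Longrightarrow> p (\<lambda>_. 0) = 0"
  unfolding fs_seminorm_def
  by (drule conjunct2, drule spec[of _ "\<lambda>_. 0"], drule spec[of _ 0]) (simp add: fin_supp_def)

text \<open>\<open>fs_seminorm\<close> lists subadditivity and homogeneity; nonnegativity comes from
  0 = p(a - a) \<le> 2 p(a).\<close>

lemma fs_seminorm_nonneg:
  assumes "fs_seminorm p" "fin_supp a"
  shows "0 \<le> p a"
proof -
  have "p (\<lambda>i. a i + (-1) * a i) \<le> p a + p (\<lambda>i. (-1) * a i)"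
    using assms fin_supp_scale[of a "-1"] unfolding fs_seminorm_def by blast
  also have "p (\<lambda>i. (-1) * a i) = p a"
    using assms unfolding fs_seminorm_def by (metis abs_minus abs_one mult_1)
  finally show ?thesis
    using fs_seminorm_zero[OF assms(1)] by simp
qed

lemma fs_seminorm_tens:
  assumes "fs_seminorm p" "m \<ge> 1"
  shows "fs_seminorm (\<lambda>b. p (tens m a b))"
  unfolding fs_seminorm_def
proof (intro conjI allI impI)
  fix b b' assume bb: "fin_supp b" "fin_supp b'"
  have eq: "tens m a (\<lambda>i. b i + b' i) = (\<lambda>n. tens m a b n + tens m a b' n)"
    by (auto simp: tens_def algebra_simps)
  show "p (tens m a (\<lambda>i. b i + b' i)) \<le> p (tens m a b) + p (tens m a b')"
    unfolding eq using assms(1) bb fin_supp_tens[OF assms(2)] unfolding fs_seminorm_def by blast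
next
  fix b :: "nat \<Rightarrow> real" and c assume "fin_supp b"
  moreover have eq: "tens m a (\<lambda>i. c * b i) = (\<lambda>n. c * tens m a b n)"
    by (auto simp: tens_def algebra_simps)
  ultimately show "p (tens m a (\<lambda>i. c * b i)) = \<bar>c\<bar> * p (tens m a b)"
    unfolding eq using assms(1) fin_supp_tens[OF assms(2)] unfolding fs_seminorm_def by blast
qed

text \<open>Moving \<open>b\<close> by d places moves its blocks by d*m places.\<close>

lemma shift_invariant_tens:
  assumes "shift_invariant p" "m \<ge> 1"
  shows "shift_invariant (\<lambda>b. p (tens m a b))"
  unfolding shift_invariant_def
proof (intro allI impI)
  fix b :: "nat \<Rightarrow> real" and d assume "fin_supp b"
  have eq: "tens m a (\<lambda>i. if i < d then 0 else b (i - d)) =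
        (\<lambda>n. if n < d * m then 0 else tens m a b (n - d * m))"
  proof
    fix n
    show "tens m a (\<lambda>i. if i < d then 0 else b (i - d)) n =
        (if n < d * m then 0 else tens m a b (n - d * m))"
    proof (cases "n < d * m")
      case True
      thus ?thesis using assms(2) by (simp add: tens_def less_mult_imp_div_less)
    next
      case False
      then obtain r where r: "n = r + d * m" by (metis le_add_diff_inverse2 not_less)
      show ?thesis using assms(2) by (simp add: tens_def r)
    qed
  qed
  show "p (tens m a (\<lambda>i. if i < d then 0 else b (i - d))) = p (tens m a b)"
    unfolding eq using assms(1) fin_supp_tens[OF assms(2) \<open>fin_supp b\<close>]
    unfolding shift_invariant_def by blast
qed

lemma tens_trunc_Suc:
  assumes "m \<ge> 1"
  shows "tens m a (trunc (Suc l) b) =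
    (\<lambda>n. tens m a (trunc l b) n + b l * (if n < l * m then 0 else trunc m a (n - l * m)))"
proof
  fix n
  show "tens m a (trunc (Suc l) b) n =
    tens m a (trunc l b) n + b l * (if n < l * m then 0 else trunc m a (n - l * m))"
  proof (cases "n < l * m")
    case True
    thus ?thesis by (simp add: tens_def trunc_def less_mult_imp_div_less less_SucI)
  next
    case False
    then obtain r where r: "n = r + l * m" by (metis le_add_diff_inverse2 not_less)
    show ?thesis
      using assms by (cases "r < m") (auto simp: tens_def r trunc_def div_eq_0_iff)
  qed
qed

text \<open>All translates of \<open>trunc m a\<close> have the same seminorm, so this is the
  triangle inequality, one block at a time.\<close>

lemma tens_upper_bound:
  assumes "fs_seminorm p" "shift_invariant p" "m \<ge> 1"
  shows "p (tens m a (trunc l b)) \<le> p (trunc m a) * (\<Sum>i<l. \<bar>b i\<bar>)"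
proof (induction l)
  case 0
  have "tens m a (trunc 0 b) = (\<lambda>_. 0)" by (auto simp: tens_def trunc_def)
  thus ?case using fs_seminorm_zero[OF assms(1)] by simp
next
  case (Suc l)
  let ?t = "\<lambda>n. if n < l * m then 0 else trunc m a (n - l * m)"
  have ft: "fin_supp ?t" by (intro fin_supp_shift) simp
  have "p (tens m a (trunc (Suc l) b)) \<le> p (tens m a (trunc l b)) + p (\<lambda>n. b l * ?t n)"
    unfolding tens_trunc_Suc[OF assms(3)]
    using assms(1) fin_supp_tens[OF assms(3) fin_supp_trunc] fin_supp_scale[OF ft]
    unfolding fs_seminorm_def by blast
  also have "p (\<lambda>n. b l * ?t n) = \<bar>b l\<bar> * p ?t"
    using assms(1) ft unfolding fs_seminorm_def by blast
  also have "p ?t = p (trunc m a)"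
    using assms(2) fin_supp_trunc unfolding shift_invariant_def by blast
  finally show ?case using Suc by (simp add: algebra_simps)
qed

text \<open>A seminorm in the family that fails to dominate the l1 norm is small on a normalized
  vector, hence, by shift invariance, on the span of all its disjoint translates; passing to that
  span discards it.\<close>

lemma exists_tens_l1:
  assumes "finite I" "c > 0"
    and "\<And>i. i \<in> I \<Longrightarrow> fs_seminorm (p i)"
    and "\<And>i. i \<in> I \<Longrightarrow> shift_invariant (p i)"
    and "\<And>l b. c * (\<Sum>j<l. \<bar>b j\<bar>) \<le> (\<Sum>i\<in>I. p i (trunc l b))"
  shows "\<exists>i\<in>I. \<exists>m a c'. m \<ge> 1 \<and> (\<Sum>j<m. \<bar>a j\<bar>) = 1 \<and> c' > 0 \<and>
           (\<forall>l b. c' * (\<Sum>j<l. \<bar>b j\<bar>) \<le> p i (tens m a (trunc l b)))"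
  using assms
proof (induction I arbitrary: p c rule: finite_induct)
  case empty
  from empty.prems(4)[of "\<lambda>_. 1" 1] empty.prems(1) show ?case by simp
next
  case (insert i I)
  note semi = insert.prems(2) and inv = insert.prems(3)
  \<comment> \<open>If \<open>p i\<close> retains half of the constant, the trivial block of length
    1 works. Otherwise blocks are found on which \<open>p i\<close> accounts for at most half, and
    c/2 is left for the seminorms indexed by \<open>I\<close>.\<close>
  show ?case
  proof (cases "\<forall>l b. c / 2 * (\<Sum>j<l. \<bar>b j\<bar>) \<le> p i (trunc l b)")
    case True
    have "c / 2 * (\<Sum>j<l. \<bar>b j\<bar>) \<le> p i (tens 1 (\<lambda>_. 1) (trunc l b))" for l b
      unfolding tens_one using True by blast
    hence "1 \<le> (1::nat) \<and> (\<Sum>j<1::nat. \<bar>(\<lambda>_. 1) j\<bar>) = (1::real) \<and> c / 2 > 0 \<and>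
           (\<forall>l b. c / 2 * (\<Sum>j<l. \<bar>b j\<bar>) \<le> p i (tens 1 (\<lambda>_. 1) (trunc l b)))"
      using insert.prems(1) by auto
    thus ?thesis
      by (intro bexI[of _ i] exI[of _ 1] exI[of _ "\<lambda>_. 1"] exI[of _ "c / 2"]) simp_all
  next
    case False
    then obtain m a where ma: "p i (trunc m a) < c / 2 * (\<Sum>j<m. \<bar>a j\<bar>)"
      by (auto simp: not_le)
    define S where "S = (\<Sum>j<m. \<bar>a j\<bar>)"
    \<comment> \<open>Since \<open>p i\<close> is nonnegative, the strict failure forces
      \<open>a\<close> to be nonzero somewhere below \<open>m\<close>; this permits the
      normalization and gives \<open>m \<ge> 1\<close>.\<close>
    have "0 < c / 2 * S"
      using fs_seminorm_nonneg[OF semi[of i] fin_supp_trunc, of m a] ma by (simp add: S_def)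
    hence S: "S > 0" using insert.prems(1) by (simp add: zero_less_mult_iff)
    hence m: "m \<ge> 1" unfolding S_def by (cases m) auto
    define a' where "a' = (\<lambda>j. (1 / S) * a j)"
    have a'1: "(\<Sum>j<m. \<bar>a' j\<bar>) = 1"
      using S by (simp add: a'_def abs_mult sum_divide_distrib[symmetric] S_def[symmetric])
    have "trunc m a' = (\<lambda>j. (1 / S) * trunc m a j)" by (auto simp: a'_def trunc_def)
    hence "p i (trunc m a') = (1 / S) * p i (trunc m a)"
      using semi[of i] S fin_supp_trunc[of m a] unfolding fs_seminorm_def by (metis abs_of_pos insertI1 zero_less_divide_1_iff)
    hence pa': "p i (trunc m a') \<le> c / 2"
      using ma S by (simp add: pos_divide_le_eq S_def[symmetric])
    define p' where "p' = (\<lambda>i b. p i (tens m a' b))"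
    have "\<exists>i\<in>I. \<exists>m a c'. m \<ge> 1 \<and> (\<Sum>j<m. \<bar>a j\<bar>) = 1 \<and> c' > 0 \<and>
           (\<forall>l b. c' * (\<Sum>j<l. \<bar>b j\<bar>) \<le> p' i (tens m a (trunc l b)))"
    proof (rule insert.IH)
      show "c / 2 > 0" using insert.prems(1) by simp
      show "fs_seminorm (p' i)" if "i \<in> I" for i
        unfolding p'_def using semi that m by (intro fs_seminorm_tens) auto
      show "shift_invariant (p' i)" if "i \<in> I" for i
        unfolding p'_def using inv that m by (intro shift_invariant_tens) auto
      fix l b
      \<comment> \<open>The hypothesis is tested on blocks of \<open>a'\<close>: their l^1 norm is
        that of \<open>b\<close>, and \<open>p i\<close> contributes at most c/2 times it.\<close>
      have "c * (\<Sum>j<l. \<bar>b j\<bar>) = c * (\<Sum>n<l * m. \<bar>tens m a' b n\<bar>)"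
        by (simp add: sum_abs_tens a'1)
      also have "\<dots> \<le> (\<Sum>j\<in>insert i I. p j (tens m a' (trunc l b)))"
        unfolding tens_trunc[OF m] by (rule insert.prems(4))
      also have "\<dots> = p i (tens m a' (trunc l b)) + (\<Sum>j\<in>I. p' j (trunc l b))"
        using insert.hyps by (simp add: p'_def)
      also have "p i (tens m a' (trunc l b)) \<le> p i (trunc m a') * (\<Sum>j<l. \<bar>b j\<bar>)"
        using semi inv m by (intro tens_upper_bound) auto
      also have "\<dots> \<le> c / 2 * (\<Sum>j<l. \<bar>b j\<bar>)"
        using pa' by (intro mult_right_mono sum_nonneg) auto
      finally show "c / 2 * (\<Sum>j<l. \<bar>b j\<bar>) \<le> (\<Sum>j\<in>I. p' j (trunc l b))" by simp
    qed
    then obtain i' m' b' c' where i': "i' \<in> I" "m' \<ge> 1" "(\<Sum>j<m'. \<bar>b' j\<bar>) = 1" "c' > 0"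
      "\<forall>l b. c' * (\<Sum>j<l. \<bar>b j\<bar>) \<le> p' i' (tens m' b' (trunc l b))" by blast
    \<comment> \<open>The vector found for \<open>p'\<close> acts through blocks of
      \<open>a'\<close>; composing the two gives one vector for \<open>p\<close>.\<close>
    have "m * m' \<ge> 1 \<and> (\<Sum>j<m * m'. \<bar>tens m a' b' j\<bar>) = 1 \<and> c' > 0 \<and>
       (\<forall>l b. c' * (\<Sum>j<l. \<bar>b j\<bar>) \<le> p i' (tens (m * m') (tens m a' b') (trunc l b)))"
      using i' m sum_abs_tens[where m=m and l=m' and a=a' and b=b'] a'1
      by (auto simp: p'_def tens_tens mult.commute)
    thus ?thesis
      using i'(1) by (intro bexI[of _ i'] exI[of _ "m * m'"] exI[of _ "tens m a' b'"] exI[of _ c']) auto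
  qed
qed

section \<open>Plegma families and Ramsey theory\<close>

lemma sorted_list_of_set_image_strict_mono_on:
  fixes f :: "nat \<Rightarrow> nat"
  assumes "finite s" "strict_mono_on s f"
  shows "sorted_list_of_set (f ` s) = map f (sorted_list_of_set s)"
proof (rule sorted_distinct_set_unique)
  have "inj_on f s" using assms(2) by (rule strict_mono_on_imp_inj_on)
  thus "distinct (map f (sorted_list_of_set s))" using assms(1) by (simp add: distinct_map)
  have "sorted_wrt (\<lambda>x y. f x \<le> f y) (sorted_list_of_set s)"
    by (rule sorted_wrt_mono_rel[of _ "(\<le>)"])
       (use assms in \<open>auto simp: strict_mono_on_leD\<close>)
  thus "sorted (map f (sorted_list_of_set s))" by (simp add: sorted_wrt_map)
qed (use assms in auto)

lemma elt_image:
  assumes "finite s" "strict_mono_on s f" "i < card s"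
  shows "elt (f ` s) i = f (elt s i)"
  using assms by (simp add: elt_def sorted_list_of_set_image_strict_mono_on)

lemma elt_image_lessThan:
  assumes "strict_mono_on {..<n} h" "i < n"
  shows "elt (h ` {..<n}) i = h i"
proof -
  have "sorted_list_of_set {..<n} = [0..<n]"
    by (simp add: lessThan_atLeast0)
  hence "elt {..<n} i = i" using assms by (simp add: elt_def)
  thus ?thesis using assms by (simp add: elt_image)
qed

lemma elt_mem: "finite s \<Longrightarrow> i < card s \<Longrightarrow> elt s i \<in> s"
  unfolding elt_def by (metis length_sorted_list_of_set nth_mem set_sorted_list_of_set)

lemma elt_less: "finite s \<Longrightarrow> i < j \<Longrightarrow> j < card s \<Longrightarrow> elt s i < elt s j"
  unfolding elt_def using strict_sorted_list_of_set[of s]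
  by (simp add: sorted_wrt_iff_nth_less)

lemma elt_le: "finite s \<Longrightarrow> i \<le> j \<Longrightarrow> j < card s \<Longrightarrow> elt s i \<le> elt s j"
  using elt_less[of s i j] by (cases "i = j") auto

lemma image_elt: "finite s \<Longrightarrow> elt s ` {..<card s} = s"
proof -
  assume "finite s"
  have "elt s ` {..<card s} = set (sorted_list_of_set s)"
    unfolding elt_def by (subst set_conv_nth) auto
  thus ?thesis using \<open>finite s\<close> by simp
qed

lemma elt_0_le: "finite s \<Longrightarrow> n \<in> s \<Longrightarrow> elt s 0 \<le> n"
  using image_elt[of s] elt_le[of s 0] by (metis image_iff le0 lessThan_iff)

lemma ksubsetsD: "s \<in> ksubsets M k \<Longrightarrow> finite s \<and> card s = k \<and> s \<subseteq> M"
  by (simp add: ksubsets_def)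

lemma plegma_family_ksubsets: "plegma_family k M m s \<Longrightarrow> j < m \<Longrightarrow> s j \<in> ksubsets M k"
  by (simp add: plegma_family_def)

lemma plegma_family_less:
  assumes "plegma_family k M m s" "i < k" "j < j'" "j' < m"
  shows "elt (s j) i < elt (s j') i"
  using \<open>j < j'\<close> \<open>j' < m\<close>
proof (induction j')
  case (Suc j')
  have "elt (s j') i < elt (s (Suc j')) i"
    using assms(1,2) Suc.prems unfolding plegma_family_def by simp
  thus ?case using Suc by (cases "j = j'") auto
qed simp

lemma plegma_family_le:
  assumes "plegma_family k M m s" "i < k" "j \<le> j'" "j' < m"
  shows "elt (s j) i \<le> elt (s j') i"
  using plegma_family_less[OF assms(1,2), of j j'] assms(3,4) by (cases "j = j'") auto

lemma plegma_family_subset: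
  assumes "plegma_family k M m s" "\<And>j. j < m \<Longrightarrow> s j \<subseteq> M'"
  shows "plegma_family k M' m s"
  using assms unfolding plegma_family_def ksubsets_def by auto

lemma plegma_family_mono:
  assumes "plegma_family k M m s" "M \<subseteq> M'"
  shows "plegma_family k M' m s"
  using assms plegma_family_subset[OF assms(1), of M'] plegma_family_ksubsets[OF assms(1)]
  unfolding ksubsets_def by blast

text \<open>The last clause of \<open>plegma_family\<close> compares the extreme members only, and
  it gets weaker on a segment: the last member moves down, the first one moves up.\<close>

lemma plegma_family_segment:
  assumes "plegma_family k M m s" "d + m' \<le> m" "m' \<ge> 1"
  shows "plegma_family k M m' (\<lambda>j. s (d + j))"
  unfolding plegma_family_def
proof (intro conjI allI impI)
  show "s (d + j) \<in> ksubsets M k" if "j < m'" for j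
    using that assms by (intro plegma_family_ksubsets) auto
  show "elt (s (d + j)) i < elt (s (d + (j + 1))) i" if "i < k" "j + 1 < m'" for i j
    using that assms by (intro plegma_family_less[OF assms(1)]) auto
  fix i assume i: "i + 1 < k"
  have "elt (s (d + (m' - 1))) i \<le> elt (s (m - 1)) i"
    using i assms by (intro plegma_family_le[OF assms(1)]) auto
  also have "\<dots> < elt (s 0) (i + 1)"
    using i assms(1) unfolding plegma_family_def by auto
  also have "\<dots> \<le> elt (s (d + 0)) (i + 1)"
    using i assms by (intro plegma_family_le[OF assms(1)]) auto
  finally show "elt (s (d + (m' - 1))) i < elt (s (d + 0)) (i + 1)" .
qed

lemma plegma_family_ge_first:
  assumes "plegma_family k M m s" "j < m" "n \<in> s j" "k \<ge> 1"
  shows "elt (s 0) 0 \<le> n"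
proof -
  have "elt (s 0) 0 \<le> elt (s j) 0" using assms by (intro plegma_family_le[OF assms(1)]) auto
  also have "\<dots> \<le> n"
    using elt_0_le plegma_family_ksubsets[OF assms(1,2)] assms(3) by (simp add: ksubsets_def)
  finally show ?thesis .
qed

lemma interleave_less:
  fixes i j k m :: nat
  assumes "i < k" "j < m"
  shows "i * m + j < k * m"
proof -
  have "i * m + j < Suc i * m" using assms by simp
  also have "\<dots> \<le> k * m" using assms by (intro mult_right_mono) auto
  finally show ?thesis .
qed

lemma strict_mono_on_interleave_row:
  fixes h :: "nat \<Rightarrow> nat"
  assumes "strict_mono_on {..<k * m} h" "j < m"
  shows "strict_mono_on {..<k} (\<lambda>i. h (i * m + j))"
proof (rule strict_mono_onI)
  fix r s assume "r \<in> {..<k}" "s \<in> {..<k}" "r < s"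
  thus "h (r * m + j) < h (s * m + j)"
    using assms by (intro strict_mono_onD[OF assms(1)]) (auto simp: interleave_less)
qed

text \<open>Write k*m increasing numbers into a k by m table, row by row. Its columns form a plegma
  family: order inside the rows gives the first chain of inequalities, passing to the next row gives
  the second.\<close>

lemma plegma_family_interleave:
  fixes h :: "nat \<Rightarrow> nat"
  assumes "strict_mono_on {..<k * m} h" "h ` {..<k * m} \<subseteq> M" "m \<ge> 1"
  shows "plegma_family k M m (\<lambda>j. (\<lambda>i. h (i * m + j)) ` {..<k})"
  unfolding plegma_family_def
proof (intro conjI allI impI)
  have elt: "elt ((\<lambda>i. h (i * m + j)) ` {..<k}) i = h (i * m + j)" if "j < m" "i < k" for i j
    by (rule elt_image_lessThan[OF strict_mono_on_interleave_row[OF assms(1) that(1)] that(2)])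
  show "(\<lambda>i. h (i * m + j)) ` {..<k} \<in> ksubsets M k" if "j < m" for j
  proof -
    have "inj_on (\<lambda>i. h (i * m + j)) {..<k}"
      using strict_mono_on_interleave_row[OF assms(1) that] by (rule strict_mono_on_imp_inj_on)
    thus ?thesis
      using assms(2) interleave_less[OF _ that] by (auto simp: ksubsets_def card_image)
  qed
  show "elt ((\<lambda>i. h (i * m + j)) ` {..<k}) i < elt ((\<lambda>i. h (i * m + (j + 1))) ` {..<k}) i"
    if "i < k" "j + 1 < m" for i j
    using that interleave_less[of i k j m] interleave_less[of i k "j+1" m]
    by (subst (1 2) elt) (auto intro!: strict_mono_onD[OF assms(1)])
  show "elt ((\<lambda>i. h (i * m + (m - 1))) ` {..<k}) i < elt ((\<lambda>i. h (i * m + 0)) ` {..<k}) (i + 1)"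
    if "i + 1 < k" for i
    using that assms(3) interleave_less[of i k "m - 1" m] interleave_less[of "i+1" k 0 m]
    by (subst (1 2) elt) (auto intro!: strict_mono_onD[OF assms(1)])
qed

text \<open>Converse of the interleaving: a plegma family is recovered from the k*m-set of all its
  entries. Colourings of plegma families thereby become colourings of k*m-sets, the form that
  Ramsey's theorem needs.\<close>

lemma plegma_family_eq_interleave:
  assumes "plegma_family k M m s" "m \<ge> 1"
  obtains F where "F \<in> ksubsets M (k * m)"
    "\<And>j. j < m \<Longrightarrow> s j = (\<lambda>i. elt F (i * m + j)) ` {..<k}"
proof -
  define h where "h = (\<lambda>n. elt (s (n mod m)) (n div m))"
  \<comment> \<open>Consecutive entries either lie in one row, or lead from the last member at level
    i to the first member at level i + 1. The two chains of inequalities of a plegma family cover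
    exactly these cases.\<close>
  have step: "h n < h (Suc n)" if "Suc n < k * m" for n
  proof (cases "Suc (n mod m) = m")
    case True
    have eq: "Suc n div m = Suc (n div m)" "Suc n mod m = 0" "n mod m = m - 1"
      using True by (auto simp: div_Suc mod_Suc)
    have "Suc n div m < k" using that by (simp add: less_mult_imp_div_less)
    hence "n div m + 1 < k" using eq by simp
    thus ?thesis unfolding h_def eq using assms(1) unfolding plegma_family_def by simp
  next
    case False
    have eq: "Suc n div m = n div m" "Suc n mod m = Suc (n mod m)"
      using False by (auto simp: div_Suc mod_Suc)
    have "n div m < k" using that by (simp add: less_mult_imp_div_less)
    moreover have "Suc (n mod m) < m" using False assms(2) mod_less_divisor[of m n] by linarith
    ultimately show ?thesis
      unfolding h_def eq by (intro plegma_family_less[OF assms(1)]) auto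
  qed
  have mono: "strict_mono_on {..<k * m} h"
  proof (rule strict_mono_onI)
    fix r t assume "r \<in> {..<k * m}" "t \<in> {..<k * m}" "r < t"
    hence "r < t" "t < k * m" by auto
    thus "h r < h t"
    proof (induction t)
      case (Suc t) thus ?case using step[of t] by (cases "r = t") auto
    qed simp
  qed
  define F where "F = h ` {..<k * m}"
  have mem: "h n \<in> M" if "n < k * m" for n
  proof -
    have "n div m < k" using that by (simp add: less_mult_imp_div_less)
    moreover have "s (n mod m) \<in> ksubsets M k"
      using assms by (intro plegma_family_ksubsets) auto
    ultimately show ?thesis unfolding h_def using elt_mem ksubsetsD by blast
  qed
  have F: "F \<in> ksubsets M (k * m)"
    using mono mem by (auto simp: F_def ksubsets_def card_image strict_mono_on_imp_inj_on)
  moreover have "s j = (\<lambda>i. elt F (i * m + j)) ` {..<k}" if j: "j < m" for j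
  proof -
    have "s j = elt (s j) ` {..<k}"
      using image_elt ksubsetsD[OF plegma_family_ksubsets[OF assms(1) j]] by blast
    also have "\<dots> = (\<lambda>i. elt F (i * m + j)) ` {..<k}"
    proof (rule image_cong)
      fix i assume "i \<in> {..<k}"
      hence "elt F (i * m + j) = h (i * m + j)"
        unfolding F_def using j by (intro elt_image_lessThan[OF mono]) (auto simp: interleave_less)
      thus "elt (s j) i = elt F (i * m + j)" using j by (simp add: h_def)
    qed simp
    finally show ?thesis .
  qed
  ultimately show ?thesis by (rule that)
qed

section \<open>Ramsey selection and diagonal subsets\<close>

lemma Ramsey_bounded_real:
  fixes g :: "nat set \<Rightarrow> real"
  assumes "infinite M" "\<And>F. F \<in> ksubsets M r \<Longrightarrow> 0 \<le> g F \<and> g F \<le> B" "\<epsilon> > 0"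
  obtains M' where "M' \<subseteq> M" "infinite M'"
    "\<And>F F'. F \<in> ksubsets M' r \<Longrightarrow> F' \<in> ksubsets M' r \<Longrightarrow> \<bar>g F - g F'\<bar> \<le> \<epsilon>"
proof -
  \<comment> \<open>The colour is the cell of a grid of mesh \<epsilon>; as \<open>g\<close> is
    nonnegative on the sets in question, \<open>nat\<close> merges no two cells.\<close>
  define f where "f = (\<lambda>F. nat \<lfloor>g F / \<epsilon>\<rfloor>)"
  have "f F < Suc (nat \<lfloor>B / \<epsilon>\<rfloor>)" if "F \<in> ksubsets M r" for F
  proof -
    have "\<lfloor>g F / \<epsilon>\<rfloor> \<le> \<lfloor>B / \<epsilon>\<rfloor>"
      using assms(2)[OF that] assms(3) by (intro floor_mono divide_right_mono) auto
    thus ?thesis by (simp add: f_def nat_mono less_Suc_eq_le)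
  qed
  hence "\<forall>X. X \<subseteq> M \<and> finite X \<and> card X = r \<longrightarrow> f X < Suc (nat \<lfloor>B / \<epsilon>\<rfloor>)"
    by (simp add: ksubsets_def)
  from Ramsey[OF assms(1) this] obtain M' t where M': "M' \<subseteq> M" "infinite M'"
    "\<forall>X. X \<subseteq> M' \<and> finite X \<and> card X = r \<longrightarrow> f X = t" by blast
  have "\<bar>g F - g F'\<bar> \<le> \<epsilon>" if "F \<in> ksubsets M' r" "F' \<in> ksubsets M' r" for F F'
  proof -
    have "F \<in> ksubsets M r" "F' \<in> ksubsets M r" using that M'(1) by (auto simp: ksubsets_def)
    hence nn: "0 \<le> g F / \<epsilon>" "0 \<le> g F' / \<epsilon>" using assms(2,3) by auto
    have "f F = f F'" using that M'(3) by (simp add: ksubsets_def)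
    hence "\<lfloor>g F / \<epsilon>\<rfloor> = \<lfloor>g F' / \<epsilon>\<rfloor>" using nn unfolding f_def by (simp add: nat_eq_iff)
    hence "\<bar>g F / \<epsilon> - g F' / \<epsilon>\<bar> \<le> 1" by linarith
    hence "\<bar>g F - g F'\<bar> / \<epsilon> \<le> 1"
      using assms(3) by (simp add: diff_divide_distrib[symmetric] abs_divide)
    thus ?thesis using assms(3) by simp
  qed
  with M'(1,2) show ?thesis by (rule that)
qed

text \<open>Heredity preserves what has been secured when the set is thinned again for the next
  index.\<close>

lemma finite_hereditary_subset:
  fixes P :: "'i \<Rightarrow> nat set \<Rightarrow> bool"
  assumes "finite I" "infinite M"
    and ex: "\<And>i N. i \<in> I \<Longrightarrow> N \<subseteq> M \<Longrightarrow> infinite N \<Longrightarrow> \<exists>N'\<subseteq>N. infinite N' \<and> P i N'"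
    and her: "\<And>i N N'. i \<in> I \<Longrightarrow> P i N \<Longrightarrow> N' \<subseteq> N \<Longrightarrow> infinite N' \<Longrightarrow> P i N'"
  shows "\<exists>N\<subseteq>M. infinite N \<and> (\<forall>i\<in>I. P i N)"
  using assms(1) ex her
proof (induction I rule: finite_induct)
  case empty
  thus ?case using assms(2) by blast
next
  case (insert i I)
  have "\<exists>N\<subseteq>M. infinite N \<and> (\<forall>i\<in>I. P i N)"
    using insert.prems by (intro insert.IH) blast+
  then obtain N where N: "N \<subseteq> M" "infinite N" "\<forall>i\<in>I. P i N" by blast
  obtain N' where N': "N' \<subseteq> N" "infinite N'" "P i N'"
    using insert.prems(1)[OF insertI1 N(1,2)] by blast
  have "\<forall>j\<in>insert i I. P j N'" using N N' insert.prems(2) by blast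
  thus ?case using N N' by blast
qed

text \<open>Nested sets N_0, N_1, ... are chosen with \<open>P n\<close> true of N_n, together with
  d(n) in N_n. The first n values of \<open>d\<close> precede the choice of N_n, so
  \<open>P n\<close> is available only on the tail of \<open>d\<close> from n on.\<close>

lemma diagonal_hereditary_subset:
  fixes P :: "nat \<Rightarrow> nat set \<Rightarrow> bool"
  assumes "infinite M"
    and ex: "\<And>n N. N \<subseteq> M \<Longrightarrow> infinite N \<Longrightarrow> \<exists>N'\<subseteq>N. infinite N' \<and> P n N'"
    and her: "\<And>n N N'. P n N \<Longrightarrow> N' \<subseteq> N \<Longrightarrow> infinite N' \<Longrightarrow> P n N'"
  obtains d :: "nat \<Rightarrow> nat" where "strict_mono d" "range d \<subseteq> M" "\<And>n. P n (d ` {n..})"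
proof -
  have "\<exists>f. \<forall>n. (fst (f n) \<subseteq> M \<and> infinite (fst (f n)) \<and> P n (fst (f n)) \<and> snd (f n) \<in> fst (f n)) \<and>
       (fst (f (Suc n)) \<subseteq> fst (f n) \<and> snd (f n) < snd (f (Suc n)))"
  proof (rule dependent_nat_choice)
    obtain N where N: "N \<subseteq> M" "infinite N" "P 0 N" using ex[of M 0] assms(1) by blast
    from N(2) obtain n where "n \<in> N" by fastforce
    with N show "\<exists>x. fst x \<subseteq> M \<and> infinite (fst x) \<and> P 0 (fst x) \<and> snd x \<in> fst x"
      by (intro exI[of _ "(N, n)"]) auto
  next
    fix x :: "nat set \<times> nat" and n
    assume x: "fst x \<subseteq> M \<and> infinite (fst x) \<and> P n (fst x) \<and> snd x \<in> fst x"
    obtain N where N: "N \<subseteq> fst x" "infinite N" "P (Suc n) N" using ex[of "fst x" "Suc n"] x by blast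
    obtain r where "r \<in> N" "snd x < r" using N(2) by (meson infinite_nat_iff_unbounded)
    with N x show "\<exists>y. (fst y \<subseteq> M \<and> infinite (fst y) \<and> P (Suc n) (fst y) \<and> snd y \<in> fst y) \<and>
             (fst y \<subseteq> fst x \<and> snd x < snd y)"
      by (intro exI[of _ "(N, r)"]) auto
  qed
  then obtain f where f: "\<And>n. fst (f n) \<subseteq> M" "\<And>n. P n (fst (f n))"
    "\<And>n. snd (f n) \<in> fst (f n)" "\<And>n. fst (f (Suc n)) \<subseteq> fst (f n)" "\<And>n. snd (f n) < snd (f (Suc n))"
    by blast
  define d where "d = (\<lambda>n. snd (f n))"
  have d: "strict_mono d" unfolding d_def using f(5) by (simp add: strict_mono_Suc_iff)
  have anti: "fst (f r) \<subseteq> fst (f n)" if "n \<le> r" for n r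
    using lift_Suc_antimono_le[of "\<lambda>n. fst (f n)", OF f(4) that] .
  have P: "P n (d ` {n..})" for n
  proof (rule her[OF f(2)])
    show "d ` {n..} \<subseteq> fst (f n)" using f(3) anti unfolding d_def by blast
    show "infinite (d ` {n..})"
      using strict_mono_imp_inj_on[OF d] infinite_Ici
      by (metis finite_imageD inj_on_subset subset_UNIV)
  qed
  have "range d \<subseteq> M" using f(1,3) unfolding d_def by blast
  from that[OF d this P] show ?thesis .
qed

section \<open>Existence of spreading models\<close>

lemma norm_sum_scaleR_le:
  fixes y :: "nat \<Rightarrow> 'a::real_normed_vector"
  assumes "\<And>j. j < m \<Longrightarrow> norm (y j) \<le> B"
  shows "norm (\<Sum>j<m. a j *\<^sub>R y j) \<le> (\<Sum>j<m. \<bar>a j\<bar>) * B"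
proof -
  have "norm (\<Sum>j<m. a j *\<^sub>R y j) \<le> (\<Sum>j<m. \<bar>a j\<bar> * B)"
    by (rule sum_norm_le) (use assms in \<open>auto intro!: mult_left_mono\<close>)
  thus ?thesis by (simp add: sum_distrib_right)
qed

text \<open>For fixed coefficients the norm is a bounded function of the interleaved k*m-set, so
  Ramsey's theorem makes it nearly constant.\<close>

lemma plegma_norm_oscillation:
  fixes z :: "nat set \<Rightarrow> 'a::real_normed_vector"
  assumes "infinite M" "\<And>s. s \<in> ksubsets M k \<Longrightarrow> norm (z s) \<le> B" "m \<ge> 1" "\<epsilon> > 0"
  shows "\<exists>M'\<subseteq>M. infinite M' \<and> (\<forall>s s'. plegma_family k M' m s \<longrightarrow> plegma_family k M' m s' \<longrightarrow>
      \<bar>norm (\<Sum>j<m. a j *\<^sub>R z (s j)) - norm (\<Sum>j<m. a j *\<^sub>R z (s' j))\<bar> \<le> \<epsilon>)"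
proof -
  define g where "g = (\<lambda>F. norm (\<Sum>j<m. a j *\<^sub>R z ((\<lambda>i. elt F (i * m + j)) ` {..<k})))"
  have bd: "0 \<le> g F \<and> g F \<le> (\<Sum>j<m. \<bar>a j\<bar>) * B" if "F \<in> ksubsets M (k * m)" for F
  proof -
    have F: "finite F" "card F = k * m" "F \<subseteq> M" using that by (auto simp: ksubsets_def)
    have "plegma_family k M m (\<lambda>j. (\<lambda>i. elt F (i * m + j)) ` {..<k})"
      using F assms(3) elt_less[OF F(1)] elt_mem[OF F(1)]
      by (intro plegma_family_interleave) (auto simp: strict_mono_on_def)
    hence "norm (z ((\<lambda>i. elt F (i * m + j)) ` {..<k})) \<le> B" if "j < m" for j
      using that assms(2) plegma_family_ksubsets by blast
    hence "norm (\<Sum>j<m. a j *\<^sub>R z ((\<lambda>i. elt F (i * m + j)) ` {..<k})) \<le> (\<Sum>j<m. \<bar>a j\<bar>) * B"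
      by (rule norm_sum_scaleR_le)
    thus ?thesis unfolding g_def by simp
  qed
  obtain M' where M': "M' \<subseteq> M" "infinite M'"
    "\<And>F F'. F \<in> ksubsets M' (k * m) \<Longrightarrow> F' \<in> ksubsets M' (k * m) \<Longrightarrow> \<bar>g F - g F'\<bar> \<le> \<epsilon>"
    by (rule Ramsey_bounded_real[OF assms(1), of "k * m" g "(\<Sum>j<m. \<bar>a j\<bar>) * B" \<epsilon>])
       (erule bd, rule assms(4), rule that)
  have "\<bar>norm (\<Sum>j<m. a j *\<^sub>R z (s j)) - norm (\<Sum>j<m. a j *\<^sub>R z (s' j))\<bar> \<le> \<epsilon>"
    if s: "plegma_family k M' m s" and s': "plegma_family k M' m s'" for s s'
  proof -
    obtain F where F: "F \<in> ksubsets M' (k * m)"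
      "\<And>j. j < m \<Longrightarrow> s j = (\<lambda>i. elt F (i * m + j)) ` {..<k}"
      using plegma_family_eq_interleave[OF s assms(3)] by blast
    obtain F' where F': "F' \<in> ksubsets M' (k * m)"
      "\<And>j. j < m \<Longrightarrow> s' j = (\<lambda>i. elt F' (i * m + j)) ` {..<k}"
      using plegma_family_eq_interleave[OF s' assms(3)] by blast
    have "norm (\<Sum>j<m. a j *\<^sub>R z (s j)) = g F" "norm (\<Sum>j<m. a j *\<^sub>R z (s' j)) = g F'"
      unfolding g_def using F(2) F'(2) by simp_all
    thus ?thesis using M'(3)[OF F(1) F'(1)] by simp
  qed
  thus ?thesis using M'(1,2) by blast
qed

text \<open>Uniformity in the coefficients: the finitely many vectors of a grid are treated first,
  the others are rounded to the grid.\<close>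

lemma plegma_norm_oscillation_uniform:
  fixes z :: "nat set \<Rightarrow> 'a::real_normed_vector"
  assumes "infinite M" and bd: "\<And>s. s \<in> ksubsets M k \<Longrightarrow> norm (z s) \<le> B" and "\<epsilon> > 0"
  shows "\<exists>M'\<subseteq>M. infinite M' \<and> (\<forall>m a s s'. 1 \<le> m \<longrightarrow> m \<le> N \<longrightarrow> (\<forall>j<m. \<bar>a j\<bar> \<le> A) \<longrightarrow>
      plegma_family k M' m s \<longrightarrow> plegma_family k M' m s' \<longrightarrow>
      \<bar>norm (\<Sum>j<m. a j *\<^sub>R z (s j)) - norm (\<Sum>j<m. a j *\<^sub>R z (s' j))\<bar> \<le> \<epsilon>)"
proof -
  \<comment> \<open>\<open>B\<close> may be 0, while \<open>B'\<close> can be divided by. Rounding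
    at most N coefficients with error \<eta> changes a norm by at most \<epsilon>/4; doing so for
    both families adds \<epsilon>/2 to the \<epsilon>/2 allowed on the grid.\<close>
  define B' where "B' = \<bar>B\<bar> + 1"
  define \<eta> where "\<eta> = \<epsilon> / (4 * (N + 1) * B')"
  have B': "B' > 0" "\<And>s. s \<in> ksubsets M k \<Longrightarrow> norm (z s) \<le> B'"
    unfolding B'_def using bd by fastforce+
  have \<eta>: "\<eta> > 0" unfolding \<eta>_def using assms(3) B' by simp
  define V where "V = (\<lambda>i. \<eta> * real_of_int i) ` {\<lfloor>-A / \<eta>\<rfloor>..\<lfloor>A / \<eta>\<rfloor>}"
  \<comment> \<open>\<open>PiE\<close> fixes the values outside {..<m}, which keeps the set of grid
    vectors finite.\<close>
  define I where "I = (SIGMA m:{1..N}. PiE {..<m} (\<lambda>_. V))"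
  define P where "P = (\<lambda>(m, a) M'. \<forall>s s'. plegma_family k M' m s \<longrightarrow> plegma_family k M' m s' \<longrightarrow>
      \<bar>norm (\<Sum>j<m. a j *\<^sub>R z (s j)) - norm (\<Sum>j<m. a j *\<^sub>R z (s' j))\<bar> \<le> \<epsilon> / 2)"
  have "\<exists>M'\<subseteq>M. infinite M' \<and> (\<forall>i\<in>I. P i M')"
  proof (rule finite_hereditary_subset)
    show "finite I" unfolding I_def V_def by (intro finite_SigmaI finite_PiE) auto
    show "infinite M" by fact
    show "\<exists>M'\<subseteq>L. infinite M' \<and> P i M'" if "i \<in> I" "L \<subseteq> M" "infinite L" for i L
    proof -
      obtain m a where i: "i = (m, a)" by (cases i)
      have m: "m \<ge> 1" using that(1) by (auto simp: I_def i)
      have "norm (z s) \<le> B" if "s \<in> ksubsets L k" for s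
        using that \<open>L \<subseteq> M\<close> by (intro bd) (auto simp: ksubsets_def)
      from plegma_norm_oscillation[where \<epsilon> = "\<epsilon> / 2" and a = a, OF \<open>infinite L\<close> this m] assms(3)
      show ?thesis by (simp add: P_def i)
    qed
    show "P i N'" if "P i N" "N' \<subseteq> N" for i N N'
      using that plegma_family_mono unfolding P_def by (cases i) blast
  qed
  then obtain M' where M': "M' \<subseteq> M" "infinite M'" "\<And>i. i \<in> I \<Longrightarrow> P i M'" by blast
  have "\<bar>norm (\<Sum>j<m. a j *\<^sub>R z (s j)) - norm (\<Sum>j<m. a j *\<^sub>R z (s' j))\<bar> \<le> \<epsilon>"
    if m: "1 \<le> m" "m \<le> N" and a: "\<forall>j<m. \<bar>a j\<bar> \<le> A"
      and s: "plegma_family k M' m s" and s': "plegma_family k M' m s'" for m a s s'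
  proof -
    define a' where "a' = (\<lambda>j\<in>{..<m}. \<eta> * \<lfloor>a j / \<eta>\<rfloor>)"
    have "\<lfloor>a j / \<eta>\<rfloor> \<in> {\<lfloor>-A / \<eta>\<rfloor>..\<lfloor>A / \<eta>\<rfloor>}" if "j < m" for j
    proof -
      have "-A \<le> a j" "a j \<le> A" using a that by (auto simp: abs_le_iff)
      hence "-A / \<eta> \<le> a j / \<eta>" "a j / \<eta> \<le> A / \<eta>"
        using \<eta> by (intro divide_right_mono; simp)+
      thus ?thesis by (auto intro!: floor_mono)
    qed
    hence "a' \<in> PiE {..<m} (\<lambda>_. V)" unfolding a'_def V_def by auto
    hence mid: "\<bar>norm (\<Sum>j<m. a' j *\<^sub>R z (s j)) - norm (\<Sum>j<m. a' j *\<^sub>R z (s' j))\<bar> \<le> \<epsilon> / 2"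
      using M'(3)[of "(m, a')"] m s s' unfolding I_def P_def by auto
    have aa: "\<bar>a j - a' j\<bar> \<le> \<eta>" if "j < m" for j
    proof -
      have "a j - a' j = \<eta> * (a j / \<eta> - \<lfloor>a j / \<eta>\<rfloor>)"
        using that \<eta> by (simp add: a'_def algebra_simps)
      moreover have "\<bar>a j / \<eta> - \<lfloor>a j / \<eta>\<rfloor>\<bar> \<le> 1" by linarith
      ultimately show ?thesis using \<eta> by (simp add: abs_mult)
    qed
    have near: "\<bar>norm (\<Sum>j<m. a j *\<^sub>R z (t j)) - norm (\<Sum>j<m. a' j *\<^sub>R z (t j))\<bar> \<le> \<epsilon> / 4"
      if t: "plegma_family k M' m t" for t
    proof -
      have "\<bar>norm (\<Sum>j<m. a j *\<^sub>R z (t j)) - norm (\<Sum>j<m. a' j *\<^sub>R z (t j))\<bar>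
          \<le> norm (\<Sum>j<m. (a j - a' j) *\<^sub>R z (t j))"
        by (rule order_trans[OF norm_triangle_ineq3])
           (simp add: scaleR_left_diff_distrib sum_subtractf)
      also have "\<dots> \<le> (\<Sum>j<m. \<bar>a j - a' j\<bar>) * B'"
        using B'(2) plegma_family_ksubsets[OF plegma_family_mono[OF t M'(1)]]
        by (intro norm_sum_scaleR_le) blast
      also have "\<dots> \<le> (\<Sum>j<m. \<eta>) * B'"
        using aa B' by (intro mult_right_mono sum_mono) auto
      also have "\<dots> \<le> (N + 1) * \<eta> * B'"
        using m \<eta> B' by (simp add: mult_right_mono)
      also have "\<dots> = \<epsilon> / 4" using B'(1) unfolding \<eta>_def
        by (simp add: divide_simps add_nonneg_eq_0_iff)
      finally show ?thesis .
    qed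
    show ?thesis using mid near[OF s] near[OF s'] by linarith
  qed
  thus ?thesis using M'(1,2) by blast
qed

lemma trunc_trunc: "m \<le> n \<Longrightarrow> trunc n (trunc m a) = trunc m a"
  by (auto simp: trunc_def fun_eq_iff)

lemma strict_mono_le_enumerate_range:
  fixes d :: "nat \<Rightarrow> nat"
  assumes "strict_mono d"
  shows "d n \<le> enumerate (range d) n"
proof -
  have inf: "infinite (range d)"
    using assms by (simp add: range_inj_infinite strict_mono_imp_inj_on)
  have "\<exists>g. \<forall>n. enumerate (range d) n = d (g n)"
    using enumerate_in_set[OF inf] by (intro choice) blast
  then obtain g where g: "\<And>n. enumerate (range d) n = d (g n)" by blast
  have "strict_mono g"
    using enumerate_mono[OF _ inf] unfolding g strict_mono_def
    using strict_mono_less[OF assms] by blast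
  hence "n \<le> g n" by (rule strict_mono_imp_increasing)
  thus ?thesis unfolding g using strict_mono_less_eq[OF assms] by blast
qed

lemma sum_trunc_scaleR:
  fixes y :: "nat \<Rightarrow> 'a::real_vector"
  assumes "m \<le> n"
  shows "(\<Sum>j<n. trunc m a j *\<^sub>R y j) = (\<Sum>j<m. a j *\<^sub>R y j)"
  using assms by (intro sum.mono_neutral_cong_right) (auto simp: trunc_def)

text \<open>The Brunel-Sucheston construction for plegma families: all norms are stabilized along a
  diagonal subset, and the seminorm is their limit along one fixed sequence of test
  families.\<close>

lemma bounded_imp_k_spreading_model:
  fixes z :: "nat set \<Rightarrow> 'a::real_normed_vector"
  assumes k: "k \<ge> 1" and "infinite M" and bd: "\<And>s. s \<in> ksubsets M k \<Longrightarrow> norm (z s) \<le> B"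
  shows "\<exists>M'\<subseteq>M. infinite M' \<and> (\<exists>p. k_spreading_model k z M' p)"
proof -
  \<comment> \<open>The bound on the coefficients grows with \<open>n\<close>, so that every
    finitely supported \<open>a\<close> becomes admissible and the limit exists for all of them, not
    only on the unit cube.\<close>
  define P where "P = (\<lambda>n M'. \<forall>m a s s'. 1 \<le> m \<longrightarrow> m \<le> Suc n \<longrightarrow> (\<forall>j<m. \<bar>a j\<bar> \<le> real (Suc n)) \<longrightarrow>
      plegma_family k M' m s \<longrightarrow> plegma_family k M' m s' \<longrightarrow>
      \<bar>norm (\<Sum>j<m. a j *\<^sub>R z (s j)) - norm (\<Sum>j<m. a j *\<^sub>R z (s' j))\<bar> \<le> 1 / (real n + 2))"
  obtain d :: "nat \<Rightarrow> nat" where d: "strict_mono d" "range d \<subseteq> M" "\<And>n. P n (d ` {n..})"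
  proof (rule diagonal_hereditary_subset[OF assms(2), of P])
    show "\<exists>M'\<subseteq>L. infinite M' \<and> P n M'" if "L \<subseteq> M" "infinite L" for n L
    proof -
      have "norm (z s) \<le> B" if "s \<in> ksubsets L k" for s
        using that \<open>L \<subseteq> M\<close> by (intro bd) (auto simp: ksubsets_def)
      from plegma_norm_oscillation_uniform[where \<epsilon> = "1 / (real n + 2)" and N = "Suc n" and A = "real (Suc n)",
          OF \<open>infinite L\<close> this]
      show ?thesis unfolding P_def by simp
    qed
    show "P n N'" if "P n N" "N' \<subseteq> N" for n N N'
      using that plegma_family_mono[of k N' _ _ N] unfolding P_def by blast
  qed blast
  \<comment> \<open>The n-th test family, of length n, is interleaved from d(n), ..., d(n + k*n - 1)
    and so lies in the n-th tail.\<close>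
  define S where "S = (\<lambda>n j. (\<lambda>i. d (n + (i * n + j))) ` {..<k})"
  define u where "u = (\<lambda>a n. norm (\<Sum>j<n. a j *\<^sub>R z (S n j)))"
  define p where "p = (\<lambda>a. lim (u a))"
  have S: "plegma_family k (d ` {n..}) n (S n)" if "n \<ge> 1" for n
    unfolding S_def using that strict_monoD[OF d(1)]
    by (intro plegma_family_interleave[where h = "\<lambda>r. d (n + r)"]) (auto simp: strict_mono_on_def)
  \<comment> \<open>An arbitrary family in the l-th tail is compared with a later test family;
    \<open>trunc\<close> cuts the latter to its first \<open>m\<close> members.\<close>
  have key: "\<bar>norm (\<Sum>j<m. a j *\<^sub>R z (s j)) - u (trunc m a) n\<bar> \<le> 1 / (real l + 2)"
    if "1 \<le> m" "m \<le> Suc l" "\<forall>j<m. \<bar>a j\<bar> \<le> real (Suc l)" "plegma_family k (d ` {l..}) m s"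
      "n \<ge> m" "n \<ge> l" for m a s n l
  proof -
    have "plegma_family k (d ` {n..}) m (\<lambda>j. S n (0 + j))"
      using that by (intro plegma_family_segment[OF S]) auto
    hence "plegma_family k (d ` {l..}) m (\<lambda>j. S n j)"
      unfolding add_0 by (rule plegma_family_mono) (use that(6) in auto)
    moreover have "u (trunc m a) n = norm (\<Sum>j<m. a j *\<^sub>R z (S n j))"
      unfolding u_def using that by (simp add: sum_trunc_scaleR)
    ultimately show ?thesis
      using d(3)[of l, unfolded P_def, rule_format, of m a s "S n"] that by simp
  qed
  have tends: "u a \<longlonglongrightarrow> p a" if fa: "fin_supp a" for a
  proof -
    obtain m0 where m0: "trunc m0 a = a" using fin_supp_imp_trunc[OF fa] by blast
    \<comment> \<open>\<open>Suc\<close> secures \<open>m \<ge> 1\<close>, which \<open>key\<close>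
      asks for.\<close>
    define m where "m = Suc m0"
    have ta: "trunc m a = a" unfolding m_def using m0 trunc_trunc[of m0 "Suc m0" a] by simp
    have "Cauchy (u a)"
    proof (rule CauchyI)
      fix e :: real assume e: "e > 0"
      \<comment> \<open>\<open>l\<close> has to exceed the length of \<open>a\<close>, the size of
        its entries and 1/e; past it any two test families give norms within 1/(l+2) < e.\<close>
      obtain l1 :: nat where l1: "real l1 \<ge> 1 / e" using real_arch_simple by blast
      obtain l2 :: nat where l2: "real l2 \<ge> (\<Sum>j<m. \<bar>a j\<bar>)" using real_arch_simple by blast
      define l where "l = m + l1 + l2"
      have al: "\<bar>a j\<bar> \<le> real (Suc l)" if "j < m" for j
      proof -
        have "\<bar>a j\<bar> \<le> (\<Sum>j<m. \<bar>a j\<bar>)" using that by (intro member_le_sum) auto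
        thus ?thesis using l2 by (simp add: l_def)
      qed
      have "1 / e < real l + 2" using l1 by (simp add: l_def)
      hence le: "1 / (real l + 2) < e" using e by (simp add: field_simps)
      have "norm (u a n - u a n') < e" if n: "n \<ge> l" "n' \<ge> l" for n n'
      proof -
        have l: "l \<ge> m" "m \<ge> 1" by (auto simp: l_def m_def)
        have "plegma_family k (d ` {n'..}) m (\<lambda>j. S n' (0 + j))"
          using n l by (intro plegma_family_segment[OF S]) auto
        hence "plegma_family k (d ` {l..}) m (S n')"
          unfolding add_0 by (rule plegma_family_mono) (use n in auto)
        from key[OF _ _ _ this, of a n] al n l
        have "\<bar>norm (\<Sum>j<m. a j *\<^sub>R z (S n' j)) - u a n\<bar> \<le> 1 / (real l + 2)" by (simp add: ta)
        moreover have "u a n' = norm (\<Sum>j<m. a j *\<^sub>R z (S n' j))"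
          unfolding u_def using sum_trunc_scaleR[of m n' a "\<lambda>j. z (S n' j)"] n l by (simp add: ta)
        ultimately show ?thesis using le by simp
      qed
      thus "\<exists>M. \<forall>m\<ge>M. \<forall>n\<ge>M. norm (u a m - u a n) < e" by blast
    qed
    thus ?thesis unfolding p_def by (simp add: Cauchy_convergent_iff convergent_LIMSEQ_iff)
  qed
  have semi: "fs_seminorm p"
    unfolding fs_seminorm_def
  proof (intro conjI allI impI)
    fix a b assume ab: "fin_supp a" "fin_supp b"
    have "u (\<lambda>i. a i + b i) n \<le> u a n + u b n" for n
      unfolding u_def by (simp add: scaleR_left_distrib sum.distrib norm_triangle_ineq)
    thus "p (\<lambda>i. a i + b i) \<le> p a + p b"
      by (intro LIMSEQ_le[OF tends tendsto_add[OF tends tends]] ab fin_supp_add) auto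
  next
    fix a c assume a: "fin_supp a"
    have "u (\<lambda>i. c * a i) = (\<lambda>n. \<bar>c\<bar> * u a n)"
    proof
      fix n
      have "(\<Sum>j<n. (c * a j) *\<^sub>R z (S n j)) = c *\<^sub>R (\<Sum>j<n. a j *\<^sub>R z (S n j))"
        by (simp add: scaleR_sum_right)
      thus "u (\<lambda>i. c * a i) n = \<bar>c\<bar> * u a n" unfolding u_def by simp
    qed
    hence "u (\<lambda>i. c * a i) \<longlonglongrightarrow> \<bar>c\<bar> * p a" using tends[OF a] by (auto intro: tendsto_mult)
    thus "p (\<lambda>i. c * a i) = \<bar>c\<bar> * p a"
      using tends[OF fin_supp_scale[OF a]] LIMSEQ_unique by blast
  qed
  have inf: "infinite (range d)"
    using d(1) by (simp add: range_inj_infinite strict_mono_imp_inj_on)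
  \<comment> \<open>A family starting no earlier than the element of index l - 1 lies in the tail of
    that index, where the error is 1/((l-1)+2).\<close>
  have main: "\<bar>norm (\<Sum>j<m. a j *\<^sub>R z (s j)) - p (trunc m a)\<bar> \<le> 1 / (real l + 1)"
    if l: "1 \<le> l" "1 \<le> m" "m \<le> l" and s: "plegma_family k (range d) m s"
      and first: "enumerate (range d) (l - 1) \<le> elt (s 0) 0" and a: "\<forall>j<m. \<bar>a j\<bar> \<le> 1" for l m s a
  proof -
    have "s j \<subseteq> d ` {l - 1..}" if j: "j < m" for j
    proof
      fix n assume n: "n \<in> s j"
      then obtain r where r: "n = d r"
        using ksubsetsD[OF plegma_family_ksubsets[OF s j]] by auto
      have "d (l - 1) \<le> d r"
        using strict_mono_le_enumerate_range[OF d(1), of "l - 1"] first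
          plegma_family_ge_first[OF s j n k] by (simp add: r)
      thus "n \<in> d ` {l - 1..}" using strict_mono_less_eq[OF d(1)] r by auto
    qed
    hence s': "plegma_family k (d ` {l - 1..}) m s" by (rule plegma_family_subset[OF s])
    have a': "\<forall>j<m. \<bar>a j\<bar> \<le> real (Suc (l - 1))" using a l by fastforce
    have le: "1 / (real (l - 1) + 2) = 1 / (real l + 1)" using l by (simp add: of_nat_diff)
    have "(\<lambda>n. \<bar>norm (\<Sum>j<m. a j *\<^sub>R z (s j)) - u (trunc m a) n\<bar>) \<longlonglongrightarrow>
        \<bar>norm (\<Sum>j<m. a j *\<^sub>R z (s j)) - p (trunc m a)\<bar>"
      by (intro tendsto_intros tends) simp
    moreover have "\<forall>n\<ge>l. \<bar>norm (\<Sum>j<m. a j *\<^sub>R z (s j)) - u (trunc m a) n\<bar> \<le> 1 / (real l + 1)"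
      using key[OF l(2) _ a' s'] l le by (auto simp: add.commute)
    ultimately show ?thesis by (intro Lim_bounded)
  qed
  have "(\<lambda>l. 1 / (real l + 1)) \<longlonglongrightarrow> 0" by real_asymp
  hence "k_spreading_model k z (range d) p"
    unfolding k_spreading_model_def using inf semi main
    by (intro conjI exI[of _ "\<lambda>l. 1 / (real l + 1)"]) auto
  thus ?thesis using d(2) inf by blast
qed

lemma k_spreading_modelE:
  assumes "k_spreading_model k z M p"
  obtains \<delta> :: "nat \<Rightarrow> real" where "\<forall>l. \<delta> l > 0" "\<delta> \<longlonglongrightarrow> 0"
    "\<And>l m s a. 1 \<le> l \<Longrightarrow> 1 \<le> m \<Longrightarrow> m \<le> l \<Longrightarrow> plegma_family k M m s \<Longrightarrow>
          elt (s 0) 0 \<ge> enumerate M (l - 1) \<Longrightarrow> (\<forall>j<m. \<bar>a j\<bar> \<le> 1) \<Longrightarrow>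
          \<bar>norm (\<Sum>j<m. a j *\<^sub>R z (s j)) - p (trunc m a)\<bar> \<le> \<delta> l"
proof -
  obtain \<delta> :: "nat \<Rightarrow> real" where \<delta>: "\<forall>l. \<delta> l > 0" "\<delta> \<longlonglongrightarrow> 0" and
    *: "\<forall>l m s a. 1 \<le> l \<longrightarrow> 1 \<le> m \<longrightarrow> m \<le> l \<longrightarrow> plegma_family k M m s \<longrightarrow>
          elt (s 0) 0 \<ge> enumerate M (l - 1) \<longrightarrow> (\<forall>j<m. \<bar>a j\<bar> \<le> 1) \<longrightarrow>
          \<bar>norm (\<Sum>j<m. a j *\<^sub>R z (s j)) - p (trunc m a)\<bar> \<le> \<delta> l"
    using assms unfolding k_spreading_model_def by blast
  show ?thesis by (rule that[OF \<delta>]) (use * in simp)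
qed

text \<open>The form used for a fixed length \<open>m\<close>: choose \<open>l \<ge> m\<close> with
  \<delta>(l) < \<epsilon>, and let N be the element of \<open>M\<close> of index l - 1.\<close>

lemma k_spreading_model_eventually:
  assumes "k_spreading_model k z M p" "m \<ge> 1" "\<epsilon> > 0"
  shows "\<exists>N. \<forall>s a. plegma_family k M m s \<longrightarrow> N \<le> elt (s 0) 0 \<longrightarrow> (\<forall>j<m. \<bar>a j\<bar> \<le> 1) \<longrightarrow>
     \<bar>norm (\<Sum>j<m. a j *\<^sub>R z (s j)) - p (trunc m a)\<bar> \<le> \<epsilon>"
proof -
  obtain \<delta> :: "nat \<Rightarrow> real" where \<delta>: "\<forall>l. \<delta> l > 0" "\<delta> \<longlonglongrightarrow> 0"
    "\<And>l m s a. 1 \<le> l \<Longrightarrow> 1 \<le> m \<Longrightarrow> m \<le> l \<Longrightarrow> plegma_family k M m s \<Longrightarrow>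
          elt (s 0) 0 \<ge> enumerate M (l - 1) \<Longrightarrow> (\<forall>j<m. \<bar>a j\<bar> \<le> 1) \<Longrightarrow>
          \<bar>norm (\<Sum>j<m. a j *\<^sub>R z (s j)) - p (trunc m a)\<bar> \<le> \<delta> l"
    by (rule k_spreading_modelE[OF assms(1)]) (rule that)
  have "eventually (\<lambda>l. \<delta> l < \<epsilon>) sequentially" using \<delta>(2) assms(3) by (rule order_tendstoD)
  then obtain l0 where l0: "\<And>l. l \<ge> l0 \<Longrightarrow> \<delta> l < \<epsilon>" unfolding eventually_sequentially by blast
  define l where "l = l0 + m"
  have "\<bar>norm (\<Sum>j<m. a j *\<^sub>R z (s j)) - p (trunc m a)\<bar> \<le> \<epsilon>"
    if "plegma_family k M m s" "enumerate M (l - 1) \<le> elt (s 0) 0" "\<forall>j<m. \<bar>a j\<bar> \<le> 1" for s a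
    using \<delta>(3)[of l m s a] that assms(2) l0[of l] by (fastforce simp: l_def)
  thus ?thesis by blast
qed

lemma ex_plegma_family:
  assumes "infinite M" "m \<ge> 1" "k \<ge> 1"
  shows "\<exists>s. plegma_family k M m s \<and> N \<le> elt (s 0) 0"
proof -
  define h where "h = (\<lambda>n. enumerate M (N + n))"
  have mono: "strict_mono_on {..<k * m} h"
    unfolding h_def strict_mono_on_def using assms(1) by simp
  define s where "s = (\<lambda>j. (\<lambda>i. h (i * m + j)) ` {..<k})"
  have "plegma_family k M m s"
    unfolding s_def using assms enumerate_in_set
    by (intro plegma_family_interleave mono) (auto simp: h_def)
  moreover have "elt (s 0) 0 = h (0 * m + 0)"
    unfolding s_def using assms by (intro elt_image_lessThan strict_mono_on_interleave_row[OF mono]) auto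
  moreover have "N \<le> h 0" unfolding h_def using le_enumerate[OF assms(1), of N] by simp
  ultimately show ?thesis by auto
qed

text \<open>Dropping the first d members of a plegma family leaves a plegma family that starts no
  earlier, so one and the same norm approximates both values of the seminorm.\<close>

lemma k_spreading_model_shift_invariant:
  assumes "k_spreading_model k z M p" "k \<ge> 1"
  shows "shift_invariant p"
proof -
  have semi: "fs_seminorm p" and inf: "infinite M"
    using assms(1) unfolding k_spreading_model_def by auto
  have bounded: "p (\<lambda>i. if i < d then 0 else trunc m a (i - d)) = p (trunc m a)"
    if a: "\<forall>j<m. \<bar>a j\<bar> \<le> 1" and m: "m \<ge> 1" for a m d
  proof -
    define a' where "a' = (\<lambda>i. if i < d then 0 else a (i - d))"
    have ta': "(\<lambda>i. if i < d then 0 else trunc m a (i - d)) = trunc (d + m) a'"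
      by (auto simp: trunc_def a'_def fun_eq_iff)
    have a'1: "\<forall>j<d + m. \<bar>a' j\<bar> \<le> 1" using a by (auto simp: a'_def)
    have "\<bar>p (trunc (d + m) a') - p (trunc m a)\<bar> \<le> \<epsilon>" if "\<epsilon> > 0" for \<epsilon>
    proof -
      obtain N1 where N1: "\<forall>s a. plegma_family k M m s \<longrightarrow> N1 \<le> elt (s 0) 0 \<longrightarrow> (\<forall>j<m. \<bar>a j\<bar> \<le> 1) \<longrightarrow>
         \<bar>norm (\<Sum>j<m. a j *\<^sub>R z (s j)) - p (trunc m a)\<bar> \<le> \<epsilon> / 2"
        using k_spreading_model_eventually[OF assms(1) m, of "\<epsilon> / 2"] \<open>\<epsilon> > 0\<close> by auto
      obtain N2 where N2: "\<forall>s a. plegma_family k M (d + m) s \<longrightarrow> N2 \<le> elt (s 0) 0 \<longrightarrow>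
         (\<forall>j<d + m. \<bar>a j\<bar> \<le> 1) \<longrightarrow>
         \<bar>norm (\<Sum>j<d + m. a j *\<^sub>R z (s j)) - p (trunc (d + m) a)\<bar> \<le> \<epsilon> / 2"
        using k_spreading_model_eventually[OF assms(1), of "d + m" "\<epsilon> / 2"] \<open>\<epsilon> > 0\<close> m by auto
      obtain s where s: "plegma_family k M (d + m) s" "N1 + N2 \<le> elt (s 0) 0"
        using ex_plegma_family[OF inf, of "d + m" k "N1 + N2"] m assms(2) by auto
      have s': "plegma_family k M m (\<lambda>j. s (d + j))"
        using m by (intro plegma_family_segment[OF s(1)]) auto
      have "elt (s 0) 0 \<le> elt (s (d + 0)) 0"
        using m assms(2) by (intro plegma_family_le[OF s(1)]) auto
      hence 1: "\<bar>norm (\<Sum>j<m. a j *\<^sub>R z (s (d + j))) - p (trunc m a)\<bar> \<le> \<epsilon> / 2"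
        using N1[rule_format, OF s'] s(2) a by auto
      have 2: "\<bar>norm (\<Sum>j<d + m. a' j *\<^sub>R z (s j)) - p (trunc (d + m) a')\<bar> \<le> \<epsilon> / 2"
        using N2[rule_format, OF s(1)] s(2) a'1 by auto
      have "(\<Sum>j<d + m. a' j *\<^sub>R z (s j)) = (\<Sum>j\<in>{d..<d + m}. a' j *\<^sub>R z (s j))"
        by (intro sum.mono_neutral_right) (auto simp: a'_def)
      also have "\<dots> = (\<Sum>j<m. a j *\<^sub>R z (s (d + j)))"
        by (rule sum.reindex_bij_witness[of _ "\<lambda>j. d + j" "\<lambda>j. j - d"]) (auto simp: a'_def)
      finally have "(\<Sum>j<d + m. a' j *\<^sub>R z (s j)) = (\<Sum>j<m. a j *\<^sub>R z (s (d + j)))" .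
      with 2 have "\<bar>norm (\<Sum>j<m. a j *\<^sub>R z (s (d + j))) - p (trunc (d + m) a')\<bar> \<le> \<epsilon> / 2"
        by simp
      with 1 show ?thesis by linarith
    qed
    hence "p (trunc (d + m) a') = p (trunc m a)"
      by (metis abs_le_zero_iff eq_iff_diff_eq_0 field_le_epsilon add_0)
    thus ?thesis by (simp add: ta')
  qed
  show ?thesis
    unfolding shift_invariant_def
  proof (intro allI impI)
    fix a :: "nat \<Rightarrow> real" and d assume fa: "fin_supp a"
    obtain m0 where m0: "trunc m0 a = a" using fin_supp_imp_trunc[OF fa] by blast
    define m where "m = Suc m0"
    have ta: "trunc m a = a" unfolding m_def using m0 trunc_trunc[of m0 "Suc m0" a] by simp
    \<comment> \<open>The model controls coefficients in [-1,1] only; dividing by \<open>C\<close>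
      reduces to them by homogeneity. The summand 1 keeps \<open>C\<close> positive.\<close>
    define C where "C = (\<Sum>j<m. \<bar>a j\<bar>) + 1"
    have C: "C > 0" unfolding C_def by (intro add_nonneg_pos sum_nonneg) auto
    define b where "b = (\<lambda>j. a j / C)"
    have "\<bar>a j\<bar> \<le> C" if "j < m" for j
      unfolding C_def using that member_le_sum[of j "{..<m}" "\<lambda>j. \<bar>a j\<bar>"] by auto
    hence "\<forall>j<m. \<bar>b j\<bar> \<le> 1" unfolding b_def using C by simp
    from bounded[OF this, of d]
    have eq: "p (\<lambda>i. if i < d then 0 else trunc m b (i - d)) = p (trunc m b)" by (simp add: m_def)
    have "(\<lambda>i. C * trunc m b i) = trunc m a"
      using C by (auto simp: trunc_def b_def fun_eq_iff)
    hence a: "a = (\<lambda>i. C * trunc m b i)" by (simp add: ta)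
    have "p a = \<bar>C\<bar> * p (trunc m b)"
      by (subst a) (use semi fin_supp_trunc in \<open>unfold fs_seminorm_def, blast\<close>)
    moreover have "(\<lambda>i. if i < d then 0 else a (i - d)) =
        (\<lambda>i. C * (if i < d then 0 else trunc m b (i - d)))"
      by (subst a) auto
    moreover have "p (\<lambda>i. C * (if i < d then 0 else trunc m b (i - d))) =
        \<bar>C\<bar> * p (\<lambda>i. if i < d then 0 else trunc m b (i - d))"
      using semi fin_supp_shift[OF fin_supp_trunc] unfolding fs_seminorm_def by blast
    ultimately show "p (\<lambda>i. if i < d then 0 else a (i - d)) = p a" using eq by simp
  qed
qed

section \<open>Schauder bases\<close>

definition basis_proj :: "(nat \<Rightarrow> 'a::real_normed_vector) \<Rightarrow> nat \<Rightarrow> 'a \<Rightarrow> 'a" where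
  "basis_proj b n x = (\<Sum>i<n. basis_coeff b x i *\<^sub>R b i)"

lemma basis_coeff_sums:
  assumes "schauder_basis b"
  shows "(\<lambda>n. basis_coeff b x n *\<^sub>R b n) sums x"
proof -
  have "\<exists>!c. (\<lambda>n. c n *\<^sub>R b n) sums x" using assms unfolding schauder_basis_def by blast
  thus ?thesis unfolding basis_coeff_def by (rule theI')
qed

lemma basis_coeff_unique:
  assumes "schauder_basis b" "(\<lambda>n. c n *\<^sub>R b n) sums x"
  shows "basis_coeff b x = c"
  using assms basis_coeff_sums[OF assms(1), of x] unfolding schauder_basis_def by blast

lemma basis_proj_tendsto:
  "schauder_basis b \<Longrightarrow> (\<lambda>n. basis_proj b n x) \<longlonglongrightarrow> x"
  using basis_coeff_sums[of b x] unfolding basis_proj_def sums_def .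

lemma basis_coeff_add:
  assumes "schauder_basis b"
  shows "basis_coeff b (x + y) n = basis_coeff b x n + basis_coeff b y n"
proof -
  have "basis_coeff b (x + y) = (\<lambda>n. basis_coeff b x n + basis_coeff b y n)"
    using assms sums_add[OF basis_coeff_sums[OF assms, of x] basis_coeff_sums[OF assms, of y]]
    by (intro basis_coeff_unique) (simp_all add: scaleR_left_distrib)
  thus ?thesis by simp
qed

lemma basis_coeff_scaleR:
  assumes "schauder_basis b"
  shows "basis_coeff b (r *\<^sub>R x) n = r * basis_coeff b x n"
proof -
  have "basis_coeff b (r *\<^sub>R x) = (\<lambda>n. r * basis_coeff b x n)"
    using assms bounded_linear.sums[OF bounded_linear_scaleR_right basis_coeff_sums[OF assms, of x], of r]
    by (intro basis_coeff_unique) simp_all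
  thus ?thesis by simp
qed

lemma basis_coeff_diff:
  assumes "schauder_basis b"
  shows "basis_coeff b (x - y) n = basis_coeff b x n - basis_coeff b y n"
  using basis_coeff_add[OF assms, of x "(-1) *\<^sub>R y" n] basis_coeff_scaleR[OF assms, of "-1" y n] by simp

lemma basis_proj_scaleR:
  "schauder_basis b \<Longrightarrow> basis_proj b n (r *\<^sub>R x) = r *\<^sub>R basis_proj b n x"
  by (simp add: basis_proj_def basis_coeff_scaleR scaleR_sum_right)

lemma basis_proj_diff:
  "schauder_basis b \<Longrightarrow> basis_proj b n (x - y) = basis_proj b n x - basis_proj b n y"
  by (simp add: basis_proj_def basis_coeff_diff scaleR_left_diff_distrib sum_subtractf)

lemma basis_nonzero:
  assumes "schauder_basis b"
  shows "b n \<noteq> 0"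
proof
  assume "b n = 0"
  hence "(\<lambda>i. (if i = n then 1 else 0::real) *\<^sub>R b i) = (\<lambda>_. 0)" by auto
  hence "(\<lambda>i. (if i = n then 1 else 0::real) *\<^sub>R b i) sums 0" by simp
  hence "basis_coeff b 0 = (\<lambda>i. if i = n then 1 else 0)" by (rule basis_coeff_unique[OF assms])
  moreover have "basis_coeff b 0 = (\<lambda>_. 0)" by (rule basis_coeff_unique[OF assms]) simp
  ultimately show False by (metis zero_neq_one)
qed

section \<open>Finiteness of the basis constant\<close>

lemma ex_closure_UN_interior:
  fixes A :: "nat \<Rightarrow> 'a::banach set"
  assumes "(\<Union>n. A n) = UNIV"
  obtains n x e where "e > 0" "ball x e \<subseteq> closure (A n)"
proof -
  have "\<exists>n. interior (closure (A n)) \<noteq> {}"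
  proof (rule ccontr)
    assume "\<not> ?thesis"
    hence emp: "interior (closure (A n)) = {}" for n by blast
    have "Met_TC.mtopology interior_of \<Union> (range (\<lambda>n. closure (A n))) = {}"
    proof (rule Met_TC.metric_Baire_category_alt)
      show "Met_TC.mcomplete TYPE('a)" using complete_UNIV by (simp add: mcomplete_iff_complete)
      show "countable (range (\<lambda>n. closure (A n)))" by simp
      show "closedin Met_TC.mtopology T \<and> Met_TC.mtopology interior_of T = {}"
        if "T \<in> range (\<lambda>n. closure (A n))" for T
        using that emp by auto
    qed
    moreover have "\<Union> (range (\<lambda>n. closure (A n))) = UNIV"
      using assms closure_subset by blast
    ultimately show False by simp
  qed
  then obtain n x where "x \<in> interior (closure (A n))" by blast
  then obtain e where "e > 0" "ball x e \<subseteq> closure (A n)"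
    unfolding mem_interior by blast
  thus ?thesis by (rule that)
qed

text \<open>The closed graph argument: by Baire the vectors with uniformly small partial sums are dense in
  a ball, so every vector is a sum of a fast convergent series of such vectors, along which partial
  sums may be summed termwise.\<close>

lemma basis_proj_approx:
  fixes b :: "nat \<Rightarrow> 'a::banach"
  assumes "schauder_basis b"
  obtains K where "K > 0"
    "\<And>y. \<exists>a. (\<forall>n. norm (basis_proj b n a) \<le> K * norm y) \<and> norm (y - a) \<le> norm y / 2"
proof -
  define A where "A = (\<lambda>r::nat. {x. \<forall>n. norm (basis_proj b n x) \<le> real r})"
  have "(\<Union>r. A r) = UNIV"
  proof (intro equalityI subsetI UNIV_I)
    fix x
    have "Bseq (\<lambda>n. basis_proj b n x)"
      using basis_proj_tendsto[OF assms] by (meson convergentI convergent_imp_Bseq)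
    then obtain C where "\<And>n. norm (basis_proj b n x) \<le> C" by (auto simp: Bseq_def)
    moreover obtain r :: nat where "C \<le> real r" using real_arch_simple by blast
    ultimately have "x \<in> A r" by (fastforce simp: A_def intro: order_trans)
    thus "x \<in> (\<Union>r. A r)" by blast
  qed
  then obtain r x0 e where e: "e > 0" "ball x0 e \<subseteq> closure (A r)"
    by (rule ex_closure_UN_interior)
  \<comment> \<open>\<open>A r\<close> is closed under half-differences: approximations of x0 + y
    and x0 - y from \<open>A r\<close> yield one of \<open>y\<close>. This moves the ball from x0 to
    the origin.\<close>
  have near0: "\<exists>a\<in>A r. norm (y - a) < \<eta>" if y: "norm y < e" and \<eta>: "\<eta> > 0" for y \<eta>
  proof -
    have "x0 + y \<in> closure (A r)" "x0 - y \<in> closure (A r)"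
      using e(2) y by (auto simp: dist_norm subset_iff)
    then obtain u v where uv: "u \<in> A r" "dist u (x0 + y) < \<eta>" "v \<in> A r" "dist v (x0 - y) < \<eta>"
      using \<eta> unfolding closure_approachable by blast
    define a where "a = (1/2) *\<^sub>R (u - v)"
    have "norm (basis_proj b n a) \<le> real r" for n
    proof -
      have "norm (basis_proj b n a) = norm (basis_proj b n u - basis_proj b n v) / 2"
        unfolding a_def by (simp add: basis_proj_scaleR[OF assms] basis_proj_diff[OF assms])
      also have "\<dots> \<le> (norm (basis_proj b n u) + norm (basis_proj b n v)) / 2"
        by (simp add: norm_triangle_ineq4)
      also have "\<dots> \<le> (real r + real r) / 2"
        using uv(1,3) unfolding A_def by (intro divide_right_mono add_mono) auto
      finally show ?thesis by simp
    qed
    hence "a \<in> A r" by (simp add: A_def)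
    moreover have "norm (y - a) < \<eta>"
    proof -
      have "2 *\<^sub>R (y - a) = (x0 + y - u) - (x0 - y - v)"
        unfolding a_def by (simp add: algebra_simps scaleR_2)
      hence "2 * norm (y - a) \<le> norm (x0 + y - u) + norm (x0 - y - v)"
        using norm_triangle_ineq4[of "x0 + y - u" "x0 - y - v"] norm_scaleR[of 2 "y - a"] by simp
      thus ?thesis using uv(2,4) by (simp add: dist_norm norm_minus_commute)
    qed
    ultimately show ?thesis by blast
  qed
  \<comment> \<open>The factor t = e / (2 ||y||) brings \<open>y\<close> into the ball. Scaled back,
    an error of e/4 becomes ||y||/2 and the bound r becomes r/t = 2 r ||y|| / e; r + 1 in place of r
    makes \<open>K\<close> positive.\<close>
  define K where "K = 2 * (real r + 1) / e"
  have "\<exists>a. (\<forall>n. norm (basis_proj b n a) \<le> K * norm y) \<and> norm (y - a) \<le> norm y / 2" for y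
  proof (cases "y = 0")
    case True
    have "basis_proj b n 0 = 0" for n using basis_proj_scaleR[OF assms, of n 0 0] by simp
    thus ?thesis using True by (intro exI[of _ 0]) simp
  next
    case False
    define t where "t = e / (2 * norm y)"
    have t: "t > 0" using False e by (simp add: t_def)
    have "norm (t *\<^sub>R y) < e" using t e False by (simp add: t_def)
    then obtain a where a: "a \<in> A r" "norm (t *\<^sub>R y - a) < e / 4" using near0[of "t *\<^sub>R y" "e / 4"] e by auto
    have "norm (basis_proj b n ((1 / t) *\<^sub>R a)) \<le> K * norm y" for n
    proof -
      have "norm (basis_proj b n ((1 / t) *\<^sub>R a)) = (1 / t) * norm (basis_proj b n a)"
        using t by (simp add: basis_proj_scaleR[OF assms])
      also have "\<dots> \<le> (1 / t) * (real r + 1)"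
      proof (rule mult_left_mono)
        have "norm (basis_proj b n a) \<le> real r" using a(1) by (simp add: A_def)
        thus "norm (basis_proj b n a) \<le> real r + 1" by simp
      qed (use t in simp)
      also have "\<dots> = K * norm y" using False e by (simp add: t_def K_def)
      finally show ?thesis .
    qed
    moreover have "norm (y - (1 / t) *\<^sub>R a) \<le> norm y / 2"
    proof -
      have "y - (1 / t) *\<^sub>R a = (1 / t) *\<^sub>R (t *\<^sub>R y - a)" using t by (simp add: scaleR_right_diff_distrib)
      hence "norm (y - (1 / t) *\<^sub>R a) = (1 / t) * norm (t *\<^sub>R y - a)" using t by simp
      also have "\<dots> \<le> (1 / t) * (e / 4)" using a(2) t by (intro mult_left_mono) auto
      also have "\<dots> = norm y / 2" using e False by (simp add: t_def)
      finally show ?thesis .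
    qed
    ultimately show ?thesis by blast
  qed
  moreover have "K > 0" using e by (simp add: K_def)
  ultimately show ?thesis using that by blast
qed

lemma norm_basis_coeff_le_basis_proj:
  "\<bar>basis_coeff b x n\<bar> * norm (b n) \<le> norm (basis_proj b (Suc n) x) + norm (basis_proj b n x)"
proof -
  have "basis_coeff b x n *\<^sub>R b n = basis_proj b (Suc n) x - basis_proj b n x"
    by (simp add: basis_proj_def)
  thus ?thesis
    using norm_triangle_ineq4[of "basis_proj b (Suc n) x" "basis_proj b n x"]
    by (metis norm_scaleR)
qed

text \<open>The majorant \<open>B\<close> makes the sums of the partial sums converge uniformly in
  \<open>n\<close>, so the limit over \<open>n\<close> may be exchanged with the summation over
  \<open>j\<close>. Hence the coefficients summed over \<open>j\<close> expand \<open>x\<close>, and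
  by uniqueness they are its coefficients.\<close>

lemma basis_proj_suminf:
  fixes b :: "nat \<Rightarrow> 'a::banach"
  assumes "schauder_basis b" "a sums x" "summable B" "\<And>j n. norm (basis_proj b n (a j)) \<le> B j"
  shows "norm (basis_proj b n x) \<le> suminf B"
proof -
  define g where "g = (\<lambda>n. \<Sum>j. basis_proj b n (a j))"
  define d where "d = (\<lambda>n. \<Sum>j. basis_coeff b (a j) n)"
  \<comment> \<open>A coefficient is controlled by two consecutive partial sums, whence the factor
    2.\<close>
  have summ_coeff: "summable (\<lambda>j. basis_coeff b (a j) n)" for n
  proof (rule summable_comparison_test')
    show "summable (\<lambda>j. 2 * B j / norm (b n))"
      using assms(3) by (intro summable_divide summable_mult)
    fix j
    have "\<bar>basis_coeff b (a j) n\<bar> * norm (b n) \<le> 2 * B j"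
      using norm_basis_coeff_le_basis_proj[of b "a j" n] assms(4)[of n j] assms(4)[of "Suc n" j] by linarith
    thus "norm (basis_coeff b (a j) n) \<le> 2 * B j / norm (b n)"
      using basis_nonzero[OF assms(1), of n] by (simp add: pos_le_divide_eq)
  qed
  have g_eq: "g n = (\<Sum>i<n. d i *\<^sub>R b i)" for n
  proof -
    have "(\<lambda>j. basis_coeff b (a j) i *\<^sub>R b i) sums (d i *\<^sub>R b i)" for i
      unfolding d_def using summ_coeff[of i]
      by (intro bounded_linear.sums[OF bounded_linear_scaleR_left] summable_sums)
    hence "(\<lambda>j. \<Sum>i<n. basis_coeff b (a j) i *\<^sub>R b i) sums (\<Sum>i<n. d i *\<^sub>R b i)"
      by (intro sums_sum)
    thus ?thesis unfolding g_def basis_proj_def by (rule sums_unique[symmetric])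
  qed
  have "g \<longlonglongrightarrow> x"
  proof (rule swap_uniform_limit')
    show "uniform_limit UNIV (\<lambda>J n. \<Sum>j<J. basis_proj b n (a j)) g sequentially"
      unfolding g_def by (intro Weierstrass_m_test[of UNIV _ B] assms)
    show "\<forall>\<^sub>F J in sequentially. (\<lambda>n. \<Sum>j<J. basis_proj b n (a j)) \<longlonglongrightarrow> (\<Sum>j<J. a j)"
      by (intro always_eventually allI tendsto_sum basis_proj_tendsto assms(1))
    show "(\<lambda>J. \<Sum>j<J. a j) \<longlonglongrightarrow> x" using assms(2) by (simp add: sums_def)
  qed auto
  hence "(\<lambda>i. d i *\<^sub>R b i) sums x" unfolding sums_def g_eq .
  hence "basis_coeff b x = d" by (rule basis_coeff_unique[OF assms(1)])
  hence "basis_proj b n x = g n" by (simp add: g_eq basis_proj_def)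
  also have "norm (g n) \<le> suminf B"
    unfolding g_def
  proof (rule order_trans[OF summable_norm suminf_le])
    show "summable (\<lambda>j. norm (basis_proj b n (a j)))"
      by (rule summable_comparison_test'[OF assms(3)]) (simp add: assms(4))
    thus "summable (\<lambda>j. norm (basis_proj b n (a j)))" .
  qed (use assms in auto)
  finally show ?thesis .
qed

text \<open>Approximating the remainder again and again halves it, so \<open>x\<close> is a series
  of vectors whose partial sums are bounded by K ||x|| 2^-j; these bounds add up to 2 K
  ||x||.\<close>

lemma basis_proj_bounded:
  fixes b :: "nat \<Rightarrow> 'a::banach"
  assumes "schauder_basis b"
  obtains C where "C > 0" "\<And>n x. norm (basis_proj b n x) \<le> C * norm x"
proof -
  obtain K where K: "K > 0"
    "\<And>y. \<exists>a. (\<forall>n. norm (basis_proj b n a) \<le> K * norm y) \<and> norm (y - a) \<le> norm y / 2"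
    using basis_proj_approx[OF assms] by blast
  obtain \<alpha> where \<alpha>: "\<And>y n. norm (basis_proj b n (\<alpha> y)) \<le> K * norm y"
    "\<And>y. norm (y - \<alpha> y) \<le> norm y / 2"
    using K(2) by metis
  have "norm (basis_proj b n x) \<le> (2 * K) * norm x" for n x
  proof -
    define y where "y = rec_nat x (\<lambda>_ y. y - \<alpha> y)"
    have y: "y 0 = x" "\<And>j. y (Suc j) = y j - \<alpha> (y j)" by (simp_all add: y_def)
    have ny: "norm (y j) \<le> norm x * (1/2) ^ j" for j
    proof (induction j)
      case (Suc j)
      thus ?case using \<alpha>(2)[of "y j"] y(2)[of j] by simp
    qed (simp add: y)
    have part: "(\<Sum>j<J. \<alpha> (y j)) = x - y J" for J
      by (induction J) (simp_all add: y)
    have "(\<lambda>j. norm x * (1/2) ^ j) \<longlonglongrightarrow> norm x * 0"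
      by (intro tendsto_mult tendsto_const LIMSEQ_power_zero) simp
    hence "y \<longlonglongrightarrow> 0" using ny by (intro Lim_null_comparison[of y]) auto
    hence "(\<lambda>J. x - y J) \<longlonglongrightarrow> x - 0" by (intro tendsto_diff tendsto_const)
    hence sums: "(\<lambda>j. \<alpha> (y j)) sums x" unfolding sums_def part by simp
    have B: "(\<lambda>j. K * norm x * (1/2) ^ j) sums (K * norm x * 2)"
      using geometric_sums[of "1/2::real"] by (intro sums_mult) simp
    have "norm (basis_proj b n x) \<le> (\<Sum>j. K * norm x * (1/2) ^ j)"
    proof (rule basis_proj_suminf[OF assms sums sums_summable[OF B]])
      fix j n
      have "norm (basis_proj b n (\<alpha> (y j))) \<le> K * norm (y j)" by (rule \<alpha>)
      also have "\<dots> \<le> K * (norm x * (1/2) ^ j)" using ny K by (intro mult_left_mono) auto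
      finally show "norm (basis_proj b n (\<alpha> (y j))) \<le> K * norm x * (1/2) ^ j" by simp
    qed
    thus ?thesis using sums_unique[OF B] by (simp add: mult_ac)
  qed
  moreover have "2 * K > 0" using K by simp
  ultimately show ?thesis using that by blast
qed

lemma bounded_linear_basis_coeff:
  fixes b :: "nat \<Rightarrow> 'a::banach"
  assumes "schauder_basis b"
  shows "bounded_linear (\<lambda>x. basis_coeff b x n)"
proof -
  obtain C where C: "C > 0" "\<And>n x. norm (basis_proj b n x) \<le> C * norm x"
    using basis_proj_bounded[OF assms] by blast
  show ?thesis
  proof (rule bounded_linear_intro[where K = "2 * C / norm (b n)"])
    fix x
    have "\<bar>basis_coeff b x n\<bar> * norm (b n) \<le> 2 * C * norm x"
      using norm_basis_coeff_le_basis_proj[of b x n] C(2)[of n x] C(2)[of "Suc n" x] by linarith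
    thus "norm (basis_coeff b x n) \<le> norm x * (2 * C / norm (b n))"
      using basis_nonzero[OF assms, of n] by (simp add: field_simps)
  qed (simp_all add: basis_coeff_add[OF assms] basis_coeff_scaleR[OF assms])
qed

section \<open>Coefficients and the weak topology\<close>

lemma topspace_weak_top [simp]: "topspace weak_top = UNIV"
proof -
  have "UNIV \<in> {{y. blinfun_apply f y \<in> U} | (f :: 'a \<Rightarrow>\<^sub>L real) U. open U}"
    by (intro CollectI exI[of _ 0] exI[of _ UNIV]) auto
  thus ?thesis unfolding weak_top_def topology_generated_by_topspace by blast
qed

text \<open>The target is a countable product of lines, hence metrizable; this is how weak
  compactness turns into sequential compactness of coefficient sequences.\<close>

lemma continuous_map_weak_top_basis_coeff:
  fixes b :: "nat \<Rightarrow> 'a::banach"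
  assumes "schauder_basis b"
  shows "continuous_map weak_top euclidean (basis_coeff b)"
  unfolding euclidean_product_topology[symmetric]
proof (rule continuous_map_coordinatewise_then_product)
  fix n :: nat
  obtain f :: "'a \<Rightarrow>\<^sub>L real" where f: "\<And>x. blinfun_apply f x = basis_coeff b x n"
    using bounded_linear_Blinfun_apply[OF bounded_linear_basis_coeff[OF assms, of n]] by metis
  show "continuous_map weak_top euclidean (\<lambda>x. basis_coeff b x n)"
    unfolding continuous_map_def
  proof (intro conjI allI impI)
    fix U :: "real set" assume "openin euclidean U"
    hence "{y. blinfun_apply f y \<in> U} \<in> {{y. blinfun_apply f y \<in> U} | (f :: 'a \<Rightarrow>\<^sub>L real) U. open U}"
      by auto
    hence "openin weak_top {y. blinfun_apply f y \<in> U}"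
      unfolding weak_top_def by (rule topology_generated_by_Basis)
    thus "openin weak_top {x \<in> topspace weak_top. basis_coeff b x n \<in> U}" by (simp add: f)
  qed simp
qed simp

text \<open>A substitute for the Eberlein-Smulian theorem. The limit stays in the compact image of
  the weak closure, so it is the coefficient sequence of an actual vector.\<close>

lemma weakly_rel_compact_coeff_subsequence:
  fixes b :: "nat \<Rightarrow> 'a::banach"
  assumes "schauder_basis b" "weakly_rel_compact A"
  obtains K where "A \<subseteq> K"
    "\<And>f :: nat \<Rightarrow> 'a. range f \<subseteq> K \<Longrightarrow> \<exists>y\<in>K. \<exists>r :: nat \<Rightarrow> nat. strict_mono r \<and>
       (\<forall>c. (\<lambda>n. basis_coeff b (f (r n)) c) \<longlonglongrightarrow> basis_coeff b y c)"
proof -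
  define K where "K = weak_top closure_of A"
  have "A \<subseteq> K" unfolding K_def by (simp add: closure_of_subset)
  moreover have "compactin euclidean (basis_coeff b ` K)"
    using assms(2) continuous_map_weak_top_basis_coeff[OF assms(1)]
    unfolding weakly_rel_compact_def K_def by (rule image_compactin)
  hence "seq_compact (basis_coeff b ` K)"
    by (simp add: compact_imp_seq_compact)
  hence "\<exists>y\<in>K. \<exists>r :: nat \<Rightarrow> nat. strict_mono r \<and>
       (\<forall>c. (\<lambda>n. basis_coeff b (f (r n)) c) \<longlonglongrightarrow> basis_coeff b y c)"
    if f: "range f \<subseteq> K" for f :: "nat \<Rightarrow> 'a"
  proof -
    have "\<forall>n. basis_coeff b (f n) \<in> basis_coeff b ` K" using f by blast
    with \<open>seq_compact _\<close> obtain l r where lr: "l \<in> basis_coeff b ` K" "strict_mono (r :: nat \<Rightarrow> nat)"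
      "((\<lambda>n. basis_coeff b (f n)) \<circ> r) \<longlonglongrightarrow> l"
      by (rule seq_compactE)
    then obtain y where y: "y \<in> K" "l = basis_coeff b y" by blast
    have "(\<lambda>n. basis_coeff b (f (r n)) c) \<longlonglongrightarrow> basis_coeff b y c" for c
    proof -
      have "continuous_on UNIV (\<lambda>x :: nat \<Rightarrow> real. x c)"
        by (rule continuous_on_product_coordinates)
      from continuous_on_tendsto_compose[OF this lr(3)] show ?thesis by (simp add: y o_def)
    qed
    thus ?thesis using y lr by blast
  qed
  ultimately show ?thesis by (rule that)
qed

lemma basis_coeff_finite_sum:
  assumes "schauder_basis b" "finite I"
  shows "basis_coeff b (\<Sum>i\<in>I. c i *\<^sub>R b i) = (\<lambda>i. if i \<in> I then c i else 0)"
proof (rule basis_coeff_unique[OF assms(1)])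
  have "(\<lambda>i. (if i \<in> I then c i else 0) *\<^sub>R b i) sums (\<Sum>i\<in>I. (if i \<in> I then c i else 0) *\<^sub>R b i)"
    by (rule sums_finite[OF assms(2)]) simp
  thus "(\<lambda>i. (if i \<in> I then c i else 0) *\<^sub>R b i) sums (\<Sum>i\<in>I. c i *\<^sub>R b i)"
    by (simp cong: sum.cong)
qed

section \<open>Trees of iterated limits\<close>

text \<open>A partial sum involves finitely many coefficients, so its bound passes to coordinatewise
  limits. This is why boundedness is expressed by \<open>basis_proj\<close> instead of the
  norm.\<close>

lemma basis_coeff_seq_compact_bounded:
  fixes b :: "nat \<Rightarrow> 'a::real_normed_vector"
  assumes "schauder_basis b"
    and K: "\<And>f :: nat \<Rightarrow> 'a. range f \<subseteq> K \<Longrightarrow> \<exists>y\<in>K. \<exists>r :: nat \<Rightarrow> nat. strict_mono r \<and>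
       (\<forall>c. (\<lambda>n. basis_coeff b (f (r n)) c) \<longlonglongrightarrow> basis_coeff b y c)"
    and f: "range f \<subseteq> {y\<in>K. \<forall>n. norm (basis_proj b n y) \<le> R}"
  shows "\<exists>y\<in>{y\<in>K. \<forall>n. norm (basis_proj b n y) \<le> R}. \<exists>r :: nat \<Rightarrow> nat. strict_mono r \<and>
       (\<forall>c. (\<lambda>n. basis_coeff b (f (r n)) c) \<longlonglongrightarrow> basis_coeff b y c)"
proof -
  have "range f \<subseteq> K" using f by blast
  then obtain y r where y: "y \<in> K" "strict_mono (r :: nat \<Rightarrow> nat)"
    "\<And>c. (\<lambda>n. basis_coeff b (f (r n)) c) \<longlonglongrightarrow> basis_coeff b y c"
    using K by blast
  have "norm (basis_proj b n y) \<le> R" for n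
  proof (rule Lim_norm_ubound[OF sequentially_bot])
    show "(\<lambda>m. basis_proj b n (f (r m))) \<longlonglongrightarrow> basis_proj b n y"
      unfolding basis_proj_def by (intro tendsto_sum tendsto_scaleR tendsto_const y)
    show "\<forall>\<^sub>F m in sequentially. norm (basis_proj b n (f (r m))) \<le> R"
      using f by (intro always_eventually) blast
  qed
  thus ?thesis using y by blast
qed

text \<open>The filter expresses n tending to infinity inside a set of naturals; passing to a
  smaller set is then monotonicity of filters.\<close>

lemma tendsto_at_top_principal_range:
  fixes e :: "nat \<Rightarrow> nat"
  assumes "strict_mono e" "(\<lambda>n. g (e n)) \<longlonglongrightarrow> L"
  shows "(g \<longlongrightarrow> L) (inf at_top (principal (range e)))"
  unfolding tendsto_def
proof (intro allI impI)
  fix S assume "open S" "L \<in> S"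
  with assms(2) have "\<forall>\<^sub>F n in sequentially. g (e n) \<in> S" by (simp add: tendsto_def)
  then obtain N where N: "\<And>n. n \<ge> N \<Longrightarrow> g (e n) \<in> S" unfolding eventually_sequentially by blast
  have "\<forall>m\<ge>e N. m \<in> range e \<longrightarrow> g m \<in> S"
    using N strict_mono_less_eq[OF assms(1)] by blast
  thus "\<forall>\<^sub>F m in inf at_top (principal (range e)). g m \<in> S"
    unfolding eventually_inf_principal eventually_sequentially by blast
qed

text \<open>The two sets differ only in points below d(e). This leads from the tails of the diagonal
  argument back to the whole range.\<close>

lemma at_top_principal_range_le:
  fixes d :: "nat \<Rightarrow> nat"
  assumes "strict_mono d"
  shows "inf at_top (principal (range d)) \<le> inf at_top (principal (d ` {e..}))"
proof (rule filter_leI)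
  fix P assume "eventually P (inf at_top (principal (d ` {e..})))"
  then obtain N where N: "\<And>m. m \<ge> N \<Longrightarrow> m \<in> d ` {e..} \<Longrightarrow> P m"
    unfolding eventually_inf_principal eventually_sequentially by blast
  have "P m" if m: "m \<ge> N + d e" and range: "m \<in> range d" for m
  proof -
    obtain r where r: "m = d r" using range by blast
    have "d e \<le> d r" using m r by simp
    hence "e \<le> r" using strict_mono_less_eq[OF assms] by blast
    thus ?thesis using N[of m] m r by auto
  qed
  thus "eventually P (inf at_top (principal (range d)))"
    unfolding eventually_inf_principal eventually_sequentially by blast
qed

lemma eventually_not_in_finite_at_top_principal:
  assumes "finite (t :: nat set)"
  shows "\<forall>\<^sub>F n in inf at_top (principal M). n \<notin> t"
proof -
  obtain N where "\<forall>n\<in>t. n < N" using assms finite_nat_set_iff_bounded by blast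
  hence "\<forall>n\<ge>N. n \<in> M \<longrightarrow> n \<notin> t" by auto
  thus ?thesis unfolding eventually_inf_principal eventually_sequentially by blast
qed

text \<open>Iterated limits exist along a common subset: level \<open>k - Suc i\<close> of the tree is obtained from level
  \<open>k - i\<close> by diagonalizing over the finite subsets of \<open>M\<close>.\<close>

lemma coordinatewise_limit_tree:
  fixes b :: "nat \<Rightarrow> 'a::real_normed_vector" and x :: "nat set \<Rightarrow> 'a"
  assumes K: "\<And>f :: nat \<Rightarrow> 'a. range f \<subseteq> K \<Longrightarrow> \<exists>y\<in>K. \<exists>r :: nat \<Rightarrow> nat. strict_mono r \<and>
       (\<forall>c. (\<lambda>n. basis_coeff b (f (r n)) c) \<longlonglongrightarrow> basis_coeff b y c)"
    and "infinite M" and x: "\<And>s. s \<in> ksubsets M k \<Longrightarrow> x s \<in> K" and "i \<le> k"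
  shows "\<exists>M' \<phi>. M' \<subseteq> M \<and> infinite M' \<and> (\<forall>s\<in>ksubsets M' k. \<phi> s = x s) \<and>
     (\<forall>t. t \<subseteq> M' \<longrightarrow> finite t \<longrightarrow> k - i \<le> card t \<longrightarrow> card t \<le> k \<longrightarrow> \<phi> t \<in> K) \<and>
     (\<forall>t c. t \<subseteq> M' \<longrightarrow> finite t \<longrightarrow> k - i \<le> card t \<longrightarrow> card t < k \<longrightarrow>
        ((\<lambda>n. basis_coeff b (\<phi> (insert n t)) c) \<longlongrightarrow> basis_coeff b (\<phi> t) c) (inf at_top (principal M')))"
  using \<open>i \<le> k\<close>
proof (induction i)
  case 0
  have "x t \<in> K" if "t \<subseteq> M" "finite t" "k \<le> card t" "card t \<le> k" for t
    using that by (intro x) (simp add: ksubsets_def)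
  thus ?case using \<open>infinite M\<close> by (intro exI[of _ M] exI[of _ x]) auto
next
  case (Suc i)
  then obtain M1 \<phi> where M1: "M1 \<subseteq> M" "infinite M1"
    and \<phi>x: "\<And>s. s \<in> ksubsets M1 k \<Longrightarrow> \<phi> s = x s"
    and \<phi>K: "\<And>t. t \<subseteq> M1 \<Longrightarrow> finite t \<Longrightarrow> k - i \<le> card t \<Longrightarrow> card t \<le> k \<Longrightarrow> \<phi> t \<in> K"
    and \<phi>lim: "\<And>t c. t \<subseteq> M1 \<Longrightarrow> finite t \<Longrightarrow> k - i \<le> card t \<Longrightarrow> card t < k \<Longrightarrow>
        ((\<lambda>n. basis_coeff b (\<phi> (insert n t)) c) \<longlongrightarrow> basis_coeff b (\<phi> t) c) (inf at_top (principal M1))"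
    by (metis Suc_leD)
  define j where "j = k - Suc i"
  have j: "Suc j = k - i" "j < k" using Suc.prems by (auto simp: j_def)
  define good where "good = (\<lambda>t N y. y \<in> K \<and>
     (\<forall>c. ((\<lambda>n. basis_coeff b (\<phi> (insert n t)) c) \<longlongrightarrow> basis_coeff b y c) (inf at_top (principal N))))"
  \<comment> \<open>Finite sets are numbered by \<open>set_decode\<close>, so the diagonal argument
    over the naturals reaches all of them.\<close>
  define P where "P = (\<lambda>e N. set_decode e \<subseteq> M1 \<longrightarrow> card (set_decode e) = j \<longrightarrow>
     (\<exists>y. good (set_decode e) N y))"
  obtain d :: "nat \<Rightarrow> nat" where d: "strict_mono d" "range d \<subseteq> M1" "\<And>e. P e (d ` {e..})"
  proof (rule diagonal_hereditary_subset[OF M1(2), of P])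
    fix e N assume N: "N \<subseteq> M1" "infinite N"
    define t where "t = set_decode e"
    show "\<exists>N'\<subseteq>N. infinite N' \<and> P e N'"
    proof (cases "t \<subseteq> M1 \<and> card t = j")
      case False
      thus ?thesis using N unfolding P_def t_def by blast
    next
      case True
      have ft: "finite t" by (simp add: t_def)
      \<comment> \<open>Without the points of \<open>t\<close>, every insertion leads to the next
        level.\<close>
      define N0 where "N0 = N - t"
      have N0: "infinite N0" using N ft by (simp add: N0_def)
      define f where "f = (\<lambda>n. \<phi> (insert (enumerate N0 n) t))"
      have "f n \<in> K" for n
      proof -
        have "enumerate N0 n \<in> N" "enumerate N0 n \<notin> t"
          using enumerate_in_set[OF N0, of n] by (auto simp: N0_def)
        thus ?thesis unfolding f_def using True N ft j by (intro \<phi>K) auto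
      qed
      then obtain y r where y: "y \<in> K" "strict_mono (r :: nat \<Rightarrow> nat)"
        "\<And>c. (\<lambda>n. basis_coeff b (f (r n)) c) \<longlonglongrightarrow> basis_coeff b y c"
        using K[of f] by blast
      define e' where "e' = (\<lambda>n. enumerate N0 (r n))"
      have e': "strict_mono e'"
        unfolding e'_def using y(2) N0 by (simp add: strict_mono_def)
      have "good t (range e') y"
        unfolding good_def
      proof (intro conjI allI)
        fix c
        have "(\<lambda>n. basis_coeff b (\<phi> (insert (e' n) t)) c) \<longlonglongrightarrow> basis_coeff b y c"
          using y(3)[of c] unfolding f_def e'_def .
        thus "((\<lambda>n. basis_coeff b (\<phi> (insert n t)) c) \<longlongrightarrow> basis_coeff b y c)
            (inf at_top (principal (range e')))"
          by (rule tendsto_at_top_principal_range[OF e'])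
      qed (rule y(1))
      hence "P e (range e')" unfolding P_def t_def by blast
      moreover have "infinite (range e')"
        using e' by (simp add: range_inj_infinite strict_mono_imp_inj_on)
      moreover have "range e' \<subseteq> N"
        using enumerate_in_set[OF N0] by (auto simp: e'_def N0_def)
      ultimately show ?thesis by blast
    qed
  next
    fix e N N' assume "P e N" "N' \<subseteq> N"
    have "good t N' y" if "good t N y" for t y
    proof -
      have "inf at_top (principal N') \<le> inf at_top (principal N)"
        using \<open>N' \<subseteq> N\<close> by (intro inf_mono) auto
      thus ?thesis using that unfolding good_def by (meson tendsto_mono)
    qed
    thus "P e N'" using \<open>P e N\<close> unfolding P_def by blast
  qed blast
  define M2 where "M2 = range d"
  have inf: "infinite M2"
    unfolding M2_def using d(1) by (simp add: range_inj_infinite strict_mono_imp_inj_on)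
  have ex: "\<exists>y. good t M2 y" if t: "t \<subseteq> M2" "finite t" "card t = j" for t
  proof -
    have t': "set_decode (set_encode t) = t" using t(2) by (rule set_encode_inverse)
    then obtain y where "good t (d ` {set_encode t..}) y"
      using d(2) d(3)[of "set_encode t"] t unfolding P_def M2_def by auto
    hence "good t M2 y"
      unfolding good_def M2_def by (meson at_top_principal_range_le[OF d(1)] tendsto_mono)
    thus ?thesis by blast
  qed
  \<comment> \<open>Only level \<open>j\<close> is redefined, and only after \<open>M2\<close> is
    known, so that one limit serves all of \<open>M2\<close>.\<close>
  define \<phi>' where "\<phi>' = (\<lambda>t. if card t = j then (SOME y. good t M2 y) else \<phi> t)"
  have good: "good t M2 (\<phi>' t)" if "t \<subseteq> M2" "finite t" "card t = j" for t
    using someI_ex[OF ex[OF that]] that by (simp add: \<phi>'_def)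
  have "\<phi>' s = x s" if "s \<in> ksubsets M2 k" for s
  proof -
    have "s \<in> ksubsets M1 k" using that d(2) by (auto simp: ksubsets_def M2_def)
    thus ?thesis using that j \<phi>x by (auto simp: \<phi>'_def ksubsets_def)
  qed
  moreover have "\<phi>' t \<in> K" if t: "t \<subseteq> M2" "finite t" "j \<le> card t" "card t \<le> k" for t
  proof (cases "card t = j")
    case True
    thus ?thesis using good[OF t(1,2)] by (simp add: good_def)
  next
    case False
    hence "\<phi> t \<in> K" using t d(2) j by (intro \<phi>K) (auto simp: M2_def)
    thus ?thesis using False by (simp add: \<phi>'_def)
  qed
  moreover have "((\<lambda>n. basis_coeff b (\<phi>' (insert n t)) c) \<longlongrightarrow> basis_coeff b (\<phi>' t) c)
      (inf at_top (principal M2))"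
    if t: "t \<subseteq> M2" "finite t" "j \<le> card t" "card t < k" for t c
  proof -
    have "((\<lambda>n. basis_coeff b (\<phi> (insert n t)) c) \<longlongrightarrow> basis_coeff b (\<phi>' t) c) (inf at_top (principal M2))"
    proof (cases "card t = j")
      case True
      thus ?thesis using good[OF t(1,2)] by (simp add: good_def)
    next
      case False
      hence "((\<lambda>n. basis_coeff b (\<phi> (insert n t)) c) \<longlongrightarrow> basis_coeff b (\<phi> t) c) (inf at_top (principal M1))"
        using t d(2) j by (intro \<phi>lim) (auto simp: M2_def)
      moreover have "inf at_top (principal M2) \<le> inf at_top (principal M1)"
        using d(2) unfolding M2_def by (intro inf_mono) auto
      ultimately have "((\<lambda>n. basis_coeff b (\<phi> (insert n t)) c) \<longlongrightarrow> basis_coeff b (\<phi> t) c)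
          (inf at_top (principal M2))"
        by (rule tendsto_mono[rotated])
      thus ?thesis using False by (simp add: \<phi>'_def)
    qed
    \<comment> \<open>For n outside \<open>t\<close> the set \<open>insert n t\<close> has more than
      \<open>j\<close> elements, where the old and the new function agree.\<close>
    moreover have "\<forall>\<^sub>F n in inf at_top (principal M2).
       basis_coeff b (\<phi> (insert n t)) c = basis_coeff b (\<phi>' (insert n t)) c"
      using eventually_not_in_finite_at_top_principal[OF t(2)]
      by (rule eventually_mono) (use t in \<open>simp add: \<phi>'_def\<close>)
    ultimately show ?thesis by (rule Lim_transform_eventually)
  qed
  moreover have "M2 \<subseteq> M" using d(2) M1 by (auto simp: M2_def)
  ultimately show ?case using inf unfolding j_def
    by (intro exI[of _ M2] exI[of _ \<phi>']) auto
qed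

text \<open>A gliding hump. The increments tend to 0 coordinatewise, so a large \<nu>(r) makes them
  small below the cut B(r); their expansions converge, so a large B(r+1) makes the tails small. At
  each stage only finitely many \<open>t\<close> occur, hence one choice serves all.\<close>

lemma block_selection:
  fixes b :: "nat \<Rightarrow> 'a::real_normed_vector" and \<phi> :: "nat set \<Rightarrow> 'a"
  assumes "schauder_basis b" "infinite M"
    and lim: "\<And>t c. t \<subseteq> M \<Longrightarrow> finite t \<Longrightarrow> card t < k \<Longrightarrow>
        ((\<lambda>n. basis_coeff b (\<phi> (insert n t)) c) \<longlongrightarrow> basis_coeff b (\<phi> t) c) (inf at_top (principal M))"
  obtains \<nu> B :: "nat \<Rightarrow> nat" where "strict_mono \<nu>" "range \<nu> \<subseteq> M" "mono B"
    "\<And>r t. t \<subseteq> {..<r} \<Longrightarrow> card t < k \<Longrightarrow>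
       norm (basis_proj b (B r) (\<phi> (\<nu> ` insert r t) - \<phi> (\<nu> ` t))) \<le> 1 / (real r + 1)"
    "\<And>r t. t \<subseteq> {..<r} \<Longrightarrow> card t < k \<Longrightarrow>
       norm (\<phi> (\<nu> ` insert r t) - \<phi> (\<nu> ` t) -
         basis_proj b (B (Suc r)) (\<phi> (\<nu> ` insert r t) - \<phi> (\<nu> ` t))) \<le> 1 / (real r + 1)"
proof -
  define y where "y = (\<lambda>n t. \<phi> (insert n t) - \<phi> t)"
  define step where "step = (\<lambda>(r::nat) (D, B) n (B'::nat). n \<in> M \<and> (\<forall>m\<in>D. m < n) \<and> B \<le> B' \<and>
     (\<forall>t\<subseteq>D. card t < k \<longrightarrow> norm (basis_proj b B (y n t)) \<le> 1 / (real r + 1) \<and>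
        norm (y n t - basis_proj b B' (y n t)) \<le> 1 / (real r + 1)))"
  have small: "\<forall>\<^sub>F n in inf at_top (principal M). norm (basis_proj b B (y n t)) < \<epsilon>"
    if "t \<subseteq> M" "finite t" "card t < k" "\<epsilon> > 0" for B t \<epsilon>
  proof -
    have "((\<lambda>n. \<Sum>c<B. (basis_coeff b (\<phi> (insert n t)) c - basis_coeff b (\<phi> t) c) *\<^sub>R b c) \<longlongrightarrow>
        (\<Sum>c<B. (basis_coeff b (\<phi> t) c - basis_coeff b (\<phi> t) c) *\<^sub>R b c)) (inf at_top (principal M))"
      using that by (intro tendsto_sum tendsto_scaleR tendsto_diff tendsto_const lim)
    hence "((\<lambda>n. basis_proj b B (y n t)) \<longlongrightarrow> 0) (inf at_top (principal M))"
      by (simp add: basis_proj_def y_def basis_coeff_diff[OF assms(1)])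
    thus ?thesis using that(4) by (auto simp: tendsto_iff dist_norm)
  qed
  have ex: "\<exists>n B'. step r (D, B) n B'" if D: "finite D" "D \<subseteq> M" for r D B
  proof -
    define T where "T = {t. t \<subseteq> D \<and> card t < k}"
    have T: "finite T" unfolding T_def using D by simp
    have "\<forall>\<^sub>F n in inf at_top (principal M). \<forall>t\<in>T. norm (basis_proj b B (y n t)) < 1 / (real r + 1)"
      using T
    proof (rule eventually_ball_finite, intro ballI)
      fix t assume "t \<in> T"
      thus "\<forall>\<^sub>F n in inf at_top (principal M). norm (basis_proj b B (y n t)) < 1 / (real r + 1)"
        using D finite_subset[of t D] by (intro small) (auto simp: T_def)
    qed
    then obtain N where N: "\<And>n. n \<ge> N \<Longrightarrow> n \<in> M \<Longrightarrow> \<forall>t\<in>T. norm (basis_proj b B (y n t)) < 1 / (real r + 1)"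
      unfolding eventually_inf_principal eventually_sequentially by blast
    obtain N' where N': "\<forall>m\<in>D. m < N'" using D(1) finite_nat_set_iff_bounded by blast
    obtain n where n: "n \<in> M" "n > N + N'" using assms(2) infinite_nat_iff_unbounded by blast
    have "\<forall>\<^sub>F B' in sequentially. \<forall>t\<in>T. norm (y n t - basis_proj b B' (y n t)) < 1 / (real r + 1)"
      using T
    proof (rule eventually_ball_finite, intro ballI)
      fix t
      show "\<forall>\<^sub>F B' in sequentially. norm (y n t - basis_proj b B' (y n t)) < 1 / (real r + 1)"
        using basis_proj_tendsto[OF assms(1), of "y n t"]
        by (simp add: tendsto_iff dist_norm norm_minus_commute)
    qed
    then obtain B0 where B0: "\<And>B'. B' \<ge> B0 \<Longrightarrow> \<forall>t\<in>T. norm (y n t - basis_proj b B' (y n t)) < 1 / (real r + 1)"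
      unfolding eventually_sequentially by blast
    have "step r (D, B) n (B + B0)"
      unfolding step_def using n N[of n] N' B0[of "B + B0"] by (fastforce simp: T_def less_imp_le)
    thus ?thesis by blast
  qed
  \<comment> \<open>A state consists of the points used so far and the current cut. The clause for r
    = 0 starts from the empty set, so the points of stage r are exactly \<nu>(0), ...,
    \<nu>(r-1).\<close>
  have "\<exists>f. \<forall>r. (finite (fst (f r)) \<and> fst (f r) \<subseteq> M \<and> (r = 0 \<longrightarrow> fst (f r) = {})) \<and>
      (\<exists>n. fst (f (Suc r)) = insert n (fst (f r)) \<and> step r (f r) n (snd (f (Suc r))))"
  proof (rule dependent_nat_choice)
    show "\<exists>x::nat set \<times> nat. finite (fst x) \<and> fst x \<subseteq> M \<and> (0 = (0::nat) \<longrightarrow> fst x = {})"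
      by (intro exI[of _ "({}, 0)"]) auto
  next
    fix x :: "nat set \<times> nat" and r :: nat
    assume x: "finite (fst x) \<and> fst x \<subseteq> M \<and> (r = 0 \<longrightarrow> fst x = {})"
    obtain n B' where nB: "step r x n B'" using ex[of "fst x" r "snd x"] x by auto
    hence "n \<in> M" by (auto simp: step_def split: prod.splits)
    thus "\<exists>z. (finite (fst z) \<and> fst z \<subseteq> M \<and> (Suc r = 0 \<longrightarrow> fst z = {})) \<and>
           (\<exists>n. fst z = insert n (fst x) \<and> step r x n (snd z))"
      using x nB by (intro exI[of _ "(insert n (fst x), B')"]) auto
  qed
  then obtain f where f: "\<forall>r. (finite (fst (f r)) \<and> fst (f r) \<subseteq> M \<and> (r = 0 \<longrightarrow> fst (f r) = {})) \<and>
      (\<exists>n. fst (f (Suc r)) = insert n (fst (f r)) \<and> step r (f r) n (snd (f (Suc r))))"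
    by (rule exE)
  have f0: "fst (f 0) = {}" using f by simp
  have fstep: "\<exists>n. fst (f (Suc r)) = insert n (fst (f r)) \<and> step r (f r) n (snd (f (Suc r)))" for r
    using f by simp
  obtain \<nu> where \<nu>: "\<And>r. fst (f (Suc r)) = insert (\<nu> r) (fst (f r))"
    "\<And>r. step r (f r) (\<nu> r) (snd (f (Suc r)))"
    using fstep by metis
  define B where "B = (\<lambda>r. snd (f r))"
  have D: "fst (f r) = \<nu> ` {..<r}" for r
    by (induction r) (auto simp: f0 \<nu> lessThan_Suc)
  have fB: "f r = (\<nu> ` {..<r}, B r)" for r by (simp add: prod_eq_iff D B_def)
  have st: "\<nu> r \<in> M" "\<And>m. m < r \<Longrightarrow> \<nu> m < \<nu> r" "B r \<le> B (Suc r)"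
    "\<And>t. t \<subseteq> \<nu> ` {..<r} \<Longrightarrow> card t < k \<Longrightarrow> norm (basis_proj b (B r) (y (\<nu> r) t)) \<le> 1 / (real r + 1) \<and>
        norm (y (\<nu> r) t - basis_proj b (B (Suc r)) (y (\<nu> r) t)) \<le> 1 / (real r + 1)" for r
    using \<nu>(2)[of r] unfolding fB step_def by (auto simp: B_def[symmetric])
  have mono: "strict_mono \<nu>" using st(2) by (simp add: strict_mono_def)
  have card: "card (\<nu> ` t) = card t" for t
    using strict_mono_imp_inj_on[OF mono] by (intro card_image) (auto intro: inj_on_subset)
  show ?thesis
  proof (rule that[of \<nu> B])
    show "strict_mono \<nu>" by (rule mono)
    show "range \<nu> \<subseteq> M" using st(1) by blast
    show "mono B" using st(3) by (simp add: mono_iff_le_Suc)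
    fix r and t :: "nat set" assume t: "t \<subseteq> {..<r}" "card t < k"
    have eq: "\<phi> (\<nu> ` insert r t) - \<phi> (\<nu> ` t) = y (\<nu> r) (\<nu> ` t)" by (simp add: y_def)
    have t': "\<nu> ` t \<subseteq> \<nu> ` {..<r}" "card (\<nu> ` t) < k" using t by (auto simp: card)
    show "norm (basis_proj b (B r) (\<phi> (\<nu> ` insert r t) - \<phi> (\<nu> ` t))) \<le> 1 / (real r + 1)"
      unfolding eq using st(4)[OF t'] by blast
    show "norm (\<phi> (\<nu> ` insert r t) - \<phi> (\<nu> ` t) -
         basis_proj b (B (Suc r)) (\<phi> (\<nu> ` insert r t) - \<phi> (\<nu> ` t))) \<le> 1 / (real r + 1)"
      unfolding eq using st(4)[OF t'] by blast
  qed
qed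

section \<open>Decomposition into blocks\<close>

text \<open>A single set is a plegma family of length 1, and \<open>enumerate M 0\<close> is the
  least element of \<open>M\<close>; so the estimate with l = m = 1 reaches every k-set in
  \<open>M\<close>.\<close>

lemma k_spreading_model_bounded:
  assumes "k_spreading_model k x M p" "k \<ge> 1"
  obtains R where "\<And>s. s \<in> ksubsets M k \<Longrightarrow> norm (x s) \<le> R"
proof -
  obtain \<delta> :: "nat \<Rightarrow> real" where \<delta>: "\<forall>l. \<delta> l > 0" "\<delta> \<longlonglongrightarrow> 0"
    "\<And>l m s a. 1 \<le> l \<Longrightarrow> 1 \<le> m \<Longrightarrow> m \<le> l \<Longrightarrow> plegma_family k M m s \<Longrightarrow>
          elt (s 0) 0 \<ge> enumerate M (l - 1) \<Longrightarrow> (\<forall>j<m. \<bar>a j\<bar> \<le> 1) \<Longrightarrow>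
          \<bar>norm (\<Sum>j<m. a j *\<^sub>R x (s j)) - p (trunc m a)\<bar> \<le> \<delta> l"
    by (rule k_spreading_modelE[OF assms(1)]) (rule that)
  have "norm (x s) \<le> p (trunc 1 (\<lambda>_. 1)) + \<delta> 1" if s: "s \<in> ksubsets M k" for s
  proof -
    have s': "finite s" "card s = k" "s \<subseteq> M" using s by (auto simp: ksubsets_def)
    have "plegma_family k M 1 (\<lambda>_. s)"
      using s elt_less[OF s'(1)] s'(2) by (simp add: plegma_family_def)
    moreover have "enumerate M (1 - 1) \<le> elt s 0"
      using elt_mem[OF s'(1), of 0] s' assms(2) by (auto simp: enumerate_0 intro!: Least_le)
    ultimately have "\<bar>norm (x s) - p (trunc 1 (\<lambda>_. 1))\<bar> \<le> \<delta> 1"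
      using \<delta>(3)[of 1 1 "\<lambda>_. s" "\<lambda>_. 1"] by simp
    thus ?thesis by simp
  qed
  thus ?thesis by (rule that)
qed

lemma basis_supp_interval:
  assumes "schauder_basis b" "m \<le> n"
  shows "basis_supp b (basis_proj b n y - basis_proj b m y) \<subseteq> {m..<n}"
proof -
  have "basis_proj b n y - basis_proj b m y = (\<Sum>c\<in>{m..<n}. basis_coeff b y c *\<^sub>R b c)"
    unfolding basis_proj_def using sum_diff_nat_ivl[of 0 m n "\<lambda>c. basis_coeff b y c *\<^sub>R b c"] assms(2)
    by (simp add: lessThan_atLeast0)
  thus ?thesis using assms(1) by (auto simp: basis_supp_def basis_coeff_finite_sum)
qed

lemma initial_segment_elt:
  assumes "finite s" "i < card s"
  shows "elt s ` {..<i} \<subseteq> {..<elt s i}" "card (elt s ` {..<i}) = i"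
proof -
  have "strict_mono_on {..<i} (elt s)"
    using assms elt_less[OF assms(1)] by (auto simp: strict_mono_on_def)
  thus "card (elt s ` {..<i}) = i" by (simp add: card_image strict_mono_on_imp_inj_on)
  show "elt s ` {..<i} \<subseteq> {..<elt s i}" using assms elt_less[OF assms(1)] by auto
qed

text \<open>The \<open>i\<close>-th component is the increment from \<open>i\<close> to \<open>i + 1\<close> of the iterated weak limits along the
  initial segments of \<open>s\<close>, cut to a finite interval; component \<open>k\<close> is the limit at the empty segment.\<close>

lemma plegma_block_decomposition:
  fixes b :: "nat \<Rightarrow> 'a::banach"
  assumes basis: "schauder_basis b" and k: "k \<ge> 1"
    and wrc: "weakly_rel_compact (x ` ksubsets UNIV k)" and model: "k_spreading_model k x M p"
  obtains \<nu> B :: "nat \<Rightarrow> nat" and Z :: "nat \<Rightarrow> nat set \<Rightarrow> 'a" and u R where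
    "strict_mono \<nu>" "range \<nu> \<subseteq> M" "mono B"
    "\<And>i s. i \<le> k \<Longrightarrow> s \<in> ksubsets UNIV k \<Longrightarrow> norm (Z i s) \<le> R"
    "\<And>s. Z k s = u"
    "\<And>i s. i < k \<Longrightarrow> s \<in> ksubsets UNIV k \<Longrightarrow>
        basis_supp b (Z i s) \<subseteq> {B (elt s i)..<B (Suc (elt s i))}"
    "\<And>s. s \<in> ksubsets UNIV k \<Longrightarrow>
        norm (x (\<nu> ` s) - (\<Sum>i\<le>k. Z i s)) \<le> 2 * real k / (real (elt s 0) + 1)"
proof -
  have M: "infinite M" using model unfolding k_spreading_model_def by blast
  obtain R0 where R0: "\<And>s. s \<in> ksubsets M k \<Longrightarrow> norm (x s) \<le> R0"
    using k_spreading_model_bounded[OF model k] by blast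
  obtain C where C: "C > 0" "\<And>n x. norm (basis_proj b n x) \<le> C * norm x"
    using basis_proj_bounded[OF basis] by blast
  obtain K0 where K0: "x ` ksubsets UNIV k \<subseteq> K0"
    "\<And>f :: nat \<Rightarrow> 'a. range f \<subseteq> K0 \<Longrightarrow> \<exists>y\<in>K0. \<exists>r :: nat \<Rightarrow> nat. strict_mono r \<and>
       (\<forall>c. (\<lambda>n. basis_coeff b (f (r n)) c) \<longlonglongrightarrow> basis_coeff b y c)"
    using weakly_rel_compact_coeff_subsequence[OF basis wrc] by blast
  \<comment> \<open>A common bound for the partial sums of all \<open>x s\<close>; through
    \<open>K\<close> every limit in the tree inherits it, which later bounds the components.\<close>
  define R where "R = C * R0"
  define K where "K = {y\<in>K0. \<forall>n. norm (basis_proj b n y) \<le> R}"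
  have Kseq: "\<exists>y\<in>K. \<exists>r :: nat \<Rightarrow> nat. strict_mono r \<and>
       (\<forall>c. (\<lambda>n. basis_coeff b (f (r n)) c) \<longlonglongrightarrow> basis_coeff b y c)"
    if "range f \<subseteq> K" for f :: "nat \<Rightarrow> 'a"
    unfolding K_def
    by (rule basis_coeff_seq_compact_bounded[OF basis K0(2) that[unfolded K_def]])
  have xK: "x s \<in> K" if s: "s \<in> ksubsets M k" for s
  proof -
    have "norm (basis_proj b n (x s)) \<le> R" for n
    proof -
      have "norm (basis_proj b n (x s)) \<le> C * norm (x s)" by (rule C)
      also have "\<dots> \<le> R" unfolding R_def using R0[OF s] C(1) by simp
      finally show ?thesis .
    qed
    moreover have "x s \<in> K0" using K0(1) s by (auto simp: ksubsets_def)
    ultimately show ?thesis by (simp add: K_def)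
  qed
  have "\<exists>M' \<phi>. M' \<subseteq> M \<and> infinite M' \<and> (\<forall>s\<in>ksubsets M' k. \<phi> s = x s) \<and>
     (\<forall>t. t \<subseteq> M' \<longrightarrow> finite t \<longrightarrow> k - k \<le> card t \<longrightarrow> card t \<le> k \<longrightarrow> \<phi> t \<in> K) \<and>
     (\<forall>t c. t \<subseteq> M' \<longrightarrow> finite t \<longrightarrow> k - k \<le> card t \<longrightarrow> card t < k \<longrightarrow>
        ((\<lambda>n. basis_coeff b (\<phi> (insert n t)) c) \<longlongrightarrow> basis_coeff b (\<phi> t) c) (inf at_top (principal M')))"
    by (rule coordinatewise_limit_tree[OF _ M _ order_refl]) (erule Kseq, erule xK)
  then obtain M1 \<phi> where M1: "M1 \<subseteq> M" "infinite M1" "\<forall>s\<in>ksubsets M1 k. \<phi> s = x s"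
    and \<phi>K: "\<forall>t. t \<subseteq> M1 \<longrightarrow> finite t \<longrightarrow> k - k \<le> card t \<longrightarrow> card t \<le> k \<longrightarrow> \<phi> t \<in> K"
    and lim': "\<forall>t c. t \<subseteq> M1 \<longrightarrow> finite t \<longrightarrow> k - k \<le> card t \<longrightarrow> card t < k \<longrightarrow>
        ((\<lambda>n. basis_coeff b (\<phi> (insert n t)) c) \<longlongrightarrow> basis_coeff b (\<phi> t) c) (inf at_top (principal M1))"
    by (elim exE conjE) (rule that)
  have lim: "((\<lambda>n. basis_coeff b (\<phi> (insert n t)) c) \<longlongrightarrow> basis_coeff b (\<phi> t) c) (inf at_top (principal M1))"
    if "t \<subseteq> M1" "finite t" "card t < k" for t c
    using lim' that by simp
  obtain \<nu> B :: "nat \<Rightarrow> nat" where \<nu>: "strict_mono \<nu>" "range \<nu> \<subseteq> M1" "mono B"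
    and low: "\<And>r t. t \<subseteq> {..<r} \<Longrightarrow> card t < k \<Longrightarrow>
       norm (basis_proj b (B r) (\<phi> (\<nu> ` insert r t) - \<phi> (\<nu> ` t))) \<le> 1 / (real r + 1)"
    and high: "\<And>r t. t \<subseteq> {..<r} \<Longrightarrow> card t < k \<Longrightarrow>
       norm (\<phi> (\<nu> ` insert r t) - \<phi> (\<nu> ` t) -
         basis_proj b (B (Suc r)) (\<phi> (\<nu> ` insert r t) - \<phi> (\<nu> ` t))) \<le> 1 / (real r + 1)"
    by (rule block_selection[OF basis M1(2), of k \<phi>]) (rule lim, assumption, assumption, assumption, rule that)
  define \<psi> where "\<psi> = (\<lambda>t. \<phi> (\<nu> ` t))"
  have \<psi>bound: "norm (basis_proj b n (\<psi> t)) \<le> R" if "finite t" "card t \<le> k" for t n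
  proof -
    have "card (\<nu> ` t) \<le> k" using that card_image_le[of t \<nu>] by simp
    hence "\<psi> t \<in> K" unfolding \<psi>_def using that \<nu>(2) by (intro \<phi>K[rule_format]) auto
    thus ?thesis by (simp add: K_def)
  qed
  define y where "y = (\<lambda>i s. \<psi> (elt s ` {..<Suc i}) - \<psi> (elt s ` {..<i}))"
  define Z where "Z = (\<lambda>i s. if i = k then \<psi> {}
     else basis_proj b (B (Suc (elt s i))) (y i s) - basis_proj b (B (elt s i)) (y i s))"
  have BSuc: "B n \<le> B (Suc n)" for n using \<nu>(3) by (simp add: monoD)
  have ybound: "norm (basis_proj b n (y i s)) \<le> 2 * R" if "i < k" "s \<in> ksubsets UNIV k" for n i s
  proof -
    have "card (elt s ` {..<Suc i}) \<le> k" "card (elt s ` {..<i}) \<le> k"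
      using that card_image_le[of "{..<Suc i}" "elt s"] card_image_le[of "{..<i}" "elt s"] by auto
    hence "norm (basis_proj b n (\<psi> (elt s ` {..<Suc i}))) \<le> R" "norm (basis_proj b n (\<psi> (elt s ` {..<i}))) \<le> R"
      by (auto intro!: \<psi>bound)
    thus ?thesis unfolding y_def basis_proj_diff[OF basis]
      by (intro order_trans[OF norm_triangle_ineq4]) linarith
  qed
  have Zbound: "norm (Z i s) \<le> 4 * R + norm (\<psi> {})" if "i \<le> k" "s \<in> ksubsets UNIV k" for i s
  proof (cases "i = k")
    case True
    \<comment> \<open>This extracts \<open>0 \<le> R\<close>, so that the summand 4 R does no
      harm.\<close>
    have "0 \<le> norm (basis_proj b 0 (\<psi> {}))" by simp
    also have "\<dots> \<le> R" by (rule \<psi>bound) auto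
    finally show ?thesis using True by (simp add: Z_def)
  next
    case False
    hence "norm (Z i s) \<le> norm (basis_proj b (B (Suc (elt s i))) (y i s)) + norm (basis_proj b (B (elt s i)) (y i s))"
      by (simp add: Z_def norm_triangle_ineq4)
    also have "\<dots> \<le> 2 * R + 2 * R" using False that by (intro add_mono ybound) auto
    finally show ?thesis by (rule order_trans) simp
  qed
  have Zk: "Z k s = \<psi> {}" for s by (simp add: Z_def)
  have Zsupp: "basis_supp b (Z i s) \<subseteq> {B (elt s i)..<B (Suc (elt s i))}"
    if "i < k" "s \<in> ksubsets UNIV k" for i s
    using that basis_supp_interval[OF basis BSuc] by (simp add: Z_def)
  have approx: "norm (x (\<nu> ` s) - (\<Sum>i\<le>k. Z i s)) \<le> 2 * real k / (real (elt s 0) + 1)"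
    if "s \<in> ksubsets UNIV k" for s
  proof -
    have s: "finite s" "card s = k" using that by (auto simp: ksubsets_def)
    have "\<nu> ` s \<in> ksubsets M1 k"
      using s \<nu>(2) strict_mono_imp_inj_on[OF \<nu>(1)]
      by (auto simp: ksubsets_def intro!: card_image intro: inj_on_subset)
    hence "x (\<nu> ` s) = \<psi> s" using M1(3) by (simp add: \<psi>_def)
    \<comment> \<open>Telescoping along the initial segments of \<open>s\<close>; the one of length
      \<open>k\<close> is \<open>s\<close> itself.\<close>
    also have "\<dots> = \<psi> {} + (\<Sum>i<k. y i s)"
      unfolding y_def sum_lessThan_telescope[of "\<lambda>i. \<psi> (elt s ` {..<i})"]
      using image_elt[OF s(1)] s(2) by simp
    finally have "x (\<nu> ` s) - (\<Sum>i\<le>k. Z i s) = (\<Sum>i<k. y i s - Z i s)"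
      by (simp add: lessThan_Suc_atMost[symmetric] sum_subtractf Z_def)
    also have "norm \<dots> \<le> (\<Sum>i<k. 2 / (real (elt s 0) + 1))"
    proof (rule sum_norm_le)
      fix i assume "i \<in> {..<k}"
      hence i: "i < card s" using s by simp
      let ?t = "elt s ` {..<i}" and ?r = "elt s i"
      have t: "?t \<subseteq> {..<?r}" "card ?t < k" using initial_segment_elt[OF s(1) i] i s by auto
      have y: "y i s = \<phi> (\<nu> ` insert ?r ?t) - \<phi> (\<nu> ` ?t)"
        by (simp add: y_def \<psi>_def lessThan_Suc)
      \<comment> \<open>Cutting loses two pieces, the one below the interval and the one beyond it;
        both were made small by the gliding hump.\<close>
      have "y i s - Z i s = (y i s - basis_proj b (B (Suc ?r)) (y i s)) + basis_proj b (B ?r) (y i s)"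
        using i s by (simp add: Z_def)
      also have "norm \<dots> \<le> 1 / (real ?r + 1) + 1 / (real ?r + 1)"
        unfolding y using low[OF t] high[OF t] by (intro norm_triangle_mono) auto
      also have "\<dots> = 2 / (real ?r + 1)" by simp
      also have "\<dots> \<le> 2 / (real (elt s 0) + 1)"
        using elt_le[OF s(1), of 0 i] i by (intro divide_left_mono mult_pos_pos) auto
      finally show "norm (y i s - Z i s) \<le> 2 / (real (elt s 0) + 1)" .
    qed
    also have "\<dots> = 2 * real k / (real (elt s 0) + 1)" by simp
    finally show ?thesis .
  qed
  have "range \<nu> \<subseteq> M" using \<nu>(2) M1(1) by blast
  from that[OF \<nu>(1) this \<nu>(3) Zbound Zk Zsupp approx] show ?thesis .
qed

lemma plegma_family_image:
  assumes "plegma_family k N m s" "strict_mono \<nu>" "range \<nu> \<subseteq> M" "m \<ge> 1"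
  shows "plegma_family k M m (\<lambda>j. \<nu> ` s j)"
proof -
  have sj: "finite (s j)" "card (s j) = k" if "j < m" for j
    using plegma_family_ksubsets[OF assms(1) that] by (auto simp: ksubsets_def)
  have elt: "elt (\<nu> ` s j) i = \<nu> (elt (s j) i)" if "j < m" "i < k" for i j
    using sj that assms(2) by (intro elt_image) (auto simp: strict_mono_def strict_mono_on_def)
  have "card (\<nu> ` s j) = k" if "j < m" for j
    using sj[OF that] strict_mono_imp_inj_on[OF assms(2)]
    by (auto intro!: card_image intro: inj_on_subset)
  hence "\<nu> ` s j \<in> ksubsets M k" if "j < m" for j
    using sj that assms(3) by (auto simp: ksubsets_def)
  thus ?thesis
    using assms(1,4) strict_monoD[OF assms(2)] unfolding plegma_family_def
    by (simp add: elt)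
qed

section \<open>Extraction of one block component\<close>

text \<open>Both sides are homogeneous, so it suffices to treat coefficients in [-1,1], the range
  covered by spreading models.\<close>

lemma l1_lower_bound_of_unit_coeffs:
  fixes p :: "'i \<Rightarrow> (nat \<Rightarrow> real) \<Rightarrow> real"
  assumes semi: "\<And>i. i \<in> I \<Longrightarrow> fs_seminorm (p i)"
    and unit: "\<And>l a. l \<ge> 1 \<Longrightarrow> (\<forall>j<l. \<bar>a j\<bar> \<le> 1) \<Longrightarrow>
      c * (\<Sum>j<l. \<bar>a j\<bar>) \<le> (\<Sum>i\<in>I. p i (trunc l a))"
  shows "c * (\<Sum>j<l. \<bar>a j\<bar>) \<le> (\<Sum>i\<in>I. p i (trunc l a))"
proof (cases "l = 0")
  case True
  have "p i (trunc 0 a) = 0" if "i \<in> I" for i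
    using fs_seminorm_zero[OF semi[OF that]] by (simp add: trunc_def)
  thus ?thesis using True by simp
next
  case False
  define C where "C = (\<Sum>j<l. \<bar>a j\<bar>) + 1"
  have C: "C > 0" unfolding C_def by (intro add_nonneg_pos sum_nonneg) auto
  define a' where "a' = (\<lambda>j. (1 / C) * a j)"
  have "\<bar>a j\<bar> \<le> C" if "j < l" for j
    unfolding C_def using that member_le_sum[of j "{..<l}" "\<lambda>j. \<bar>a j\<bar>"] by auto
  hence "\<forall>j<l. \<bar>a' j\<bar> \<le> 1" unfolding a'_def using C by (simp add: abs_mult)
  hence "c * (\<Sum>j<l. \<bar>a' j\<bar>) \<le> (\<Sum>i\<in>I. p i (trunc l a'))" using False by (intro unit) auto
  also have "\<dots> = (\<Sum>i\<in>I. (1 / C) * p i (trunc l a))"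
  proof (rule sum.cong[OF refl])
    fix i assume "i \<in> I"
    have "trunc l a' = (\<lambda>j. (1 / C) * trunc l a j)" by (auto simp: a'_def trunc_def)
    hence "p i (trunc l a') = \<bar>1 / C\<bar> * p i (trunc l a)"
      using semi[OF \<open>i \<in> I\<close>] fin_supp_trunc[of l a] unfolding fs_seminorm_def by metis
    thus "p i (trunc l a') = (1 / C) * p i (trunc l a)" using C by simp
  qed
  also have "\<dots> = (1 / C) * (\<Sum>i\<in>I. p i (trunc l a))" by (simp add: sum_distrib_left)
  finally have "(1 / C) * (c * (\<Sum>j<l. \<bar>a j\<bar>)) \<le> (1 / C) * (\<Sum>i\<in>I. p i (trunc l a))"
    using C by (simp add: a'_def abs_mult sum_divide_distrib[symmetric])
  thus ?thesis using C by (simp add: divide_le_cancel)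
qed

text \<open>All models are evaluated on a single plegma family far out, where the triangle
  inequality bounds the norm belonging to \<open>x\<close> by those belonging to the
  components.\<close>

lemma sum_k_spreading_models_l1_lower_bound:
  fixes x :: "nat set \<Rightarrow> 'a::real_normed_vector" and Z :: "'i \<Rightarrow> nat set \<Rightarrow> 'a"
  assumes k: "k \<ge> 1" and "finite I" and x: "k_spreading_model k x M\<^sub>0 p\<^sub>0"
    and c: "\<And>l a. c * (\<Sum>j<l. \<bar>a j\<bar>) \<le> p\<^sub>0 (trunc l a)"
    and \<nu>: "strict_mono \<nu>" "range \<nu> \<subseteq> M\<^sub>0"
    and Z: "\<And>i. i \<in> I \<Longrightarrow> k_spreading_model k (Z i) (M i) (p i)"
    and L: "infinite L" "\<And>i. i \<in> I \<Longrightarrow> L \<subseteq> M i"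
    and approx: "\<And>s. s \<in> ksubsets L k \<Longrightarrow>
        norm (x (\<nu> ` s) - (\<Sum>i\<in>I. Z i s)) \<le> D / (real (elt s 0) + 1)"
    and "D \<ge> 0"
  shows "c * (\<Sum>j<l. \<bar>a j\<bar>) \<le> (\<Sum>i\<in>I. p i (trunc l a))"
proof (rule l1_lower_bound_of_unit_coeffs)
  show "fs_seminorm (p i)" if "i \<in> I" for i using Z[OF that] by (simp add: k_spreading_model_def)
  fix l :: nat and a :: "nat \<Rightarrow> real" assume l: "l \<ge> 1" and a: "\<forall>j<l. \<bar>a j\<bar> \<le> 1"
  \<comment> \<open>One \<epsilon> is spent on the model of \<open>x\<close>, one on the
    approximation error and one on each component.\<close>
  have "c * (\<Sum>j<l. \<bar>a j\<bar>) \<le> (\<Sum>i\<in>I. p i (trunc l a)) + (2 + real (card I)) * \<epsilon>" if \<epsilon>: "\<epsilon> > 0" for \<epsilon>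
  proof -
    obtain N0 where N0: "\<forall>s a. plegma_family k M\<^sub>0 l s \<longrightarrow> N0 \<le> elt (s 0) 0 \<longrightarrow> (\<forall>j<l. \<bar>a j\<bar> \<le> 1) \<longrightarrow>
        \<bar>norm (\<Sum>j<l. a j *\<^sub>R x (s j)) - p\<^sub>0 (trunc l a)\<bar> \<le> \<epsilon>"
      using k_spreading_model_eventually[OF x l \<epsilon>] by blast
    have "\<exists>N. \<forall>i\<in>I. \<forall>s a. plegma_family k (M i) l s \<longrightarrow> N i \<le> elt (s 0) 0 \<longrightarrow> (\<forall>j<l. \<bar>a j\<bar> \<le> 1) \<longrightarrow>
        \<bar>norm (\<Sum>j<l. a j *\<^sub>R Z i (s j)) - p i (trunc l a)\<bar> \<le> \<epsilon>"
      using k_spreading_model_eventually[OF Z l \<epsilon>] by (intro bchoice) blast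
    then obtain N where N: "\<forall>i\<in>I. \<forall>s a. plegma_family k (M i) l s \<longrightarrow> N i \<le> elt (s 0) 0 \<longrightarrow> (\<forall>j<l. \<bar>a j\<bar> \<le> 1) \<longrightarrow>
        \<bar>norm (\<Sum>j<l. a j *\<^sub>R Z i (s j)) - p i (trunc l a)\<bar> \<le> \<epsilon>" by blast
    obtain N1 :: nat where N1: "real N1 \<ge> real l * D / \<epsilon>" using real_arch_simple by blast
    \<comment> \<open>A starting point beyond all thresholds; \<open>sum N I\<close> is at least
      each N(i).\<close>
    obtain s where s: "plegma_family k L l s" "N0 + N1 + sum N I \<le> elt (s 0) 0"
      using ex_plegma_family[OF L(1) l k] by blast
    have sj: "s j \<in> ksubsets L k" if "j < l" for j using plegma_family_ksubsets[OF s(1) that] .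
    define E where "E = (\<lambda>j. x (\<nu> ` s j) - (\<Sum>i\<in>I. Z i (s j)))"
    have err: "norm (E j) \<le> D / (real N1 + 1)" if j: "j < l" for j
    proof -
      have "elt (s 0) 0 \<le> elt (s j) 0" using j k by (intro plegma_family_le[OF s(1)]) auto
      hence "N1 \<le> elt (s j) 0" using s(2) by simp
      hence "D / (real (elt (s j) 0) + 1) \<le> D / (real N1 + 1)"
        using \<open>D \<ge> 0\<close> by (intro divide_left_mono mult_pos_pos) auto
      thus ?thesis unfolding E_def using approx[OF sj[OF j]] by linarith
    qed
    have "plegma_family k M\<^sub>0 l (\<lambda>j. \<nu> ` s j)" by (rule plegma_family_image[OF s(1) \<nu> l])
    \<comment> \<open>An increasing \<nu> satisfies \<nu>(n) \<ge> n, so the image family starts no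
      earlier than \<open>s\<close>.\<close>
    moreover have "N0 \<le> elt (\<nu> ` s 0) 0"
    proof -
      have s0: "finite (s 0)" "card (s 0) = k" using sj[of 0] l by (auto simp: ksubsets_def)
      have "elt (\<nu> ` s 0) 0 = \<nu> (elt (s 0) 0)"
        using s0 k \<nu>(1) by (intro elt_image) (auto simp: strict_mono_def strict_mono_on_def)
      thus ?thesis using s(2) strict_mono_imp_increasing[OF \<nu>(1), of "elt (s 0) 0"] by linarith
    qed
    ultimately have "p\<^sub>0 (trunc l a) \<le> norm (\<Sum>j<l. a j *\<^sub>R x (\<nu> ` s j)) + \<epsilon>"
      using N0[rule_format, of "\<lambda>j. \<nu> ` s j" a] a by fastforce
    also have "(\<Sum>j<l. a j *\<^sub>R x (\<nu> ` s j)) = (\<Sum>j<l. a j *\<^sub>R (\<Sum>i\<in>I. Z i (s j))) + (\<Sum>j<l. a j *\<^sub>R E j)"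
      by (simp add: E_def sum.distrib[symmetric] scaleR_right_diff_distrib)
    also have "(\<Sum>j<l. a j *\<^sub>R (\<Sum>i\<in>I. Z i (s j))) = (\<Sum>i\<in>I. \<Sum>j<l. a j *\<^sub>R Z i (s j))"
      by (simp add: scaleR_sum_right) (rule sum.swap)
    also have "norm ((\<Sum>i\<in>I. \<Sum>j<l. a j *\<^sub>R Z i (s j)) + (\<Sum>j<l. a j *\<^sub>R E j)) \<le>
        (\<Sum>i\<in>I. p i (trunc l a) + \<epsilon>) + \<epsilon>"
    proof (rule norm_triangle_mono)
      show "norm (\<Sum>i\<in>I. \<Sum>j<l. a j *\<^sub>R Z i (s j)) \<le> (\<Sum>i\<in>I. p i (trunc l a) + \<epsilon>)"
      proof (rule sum_norm_le)
        fix i assume i: "i \<in> I"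
        have "N i \<le> sum N I" using i \<open>finite I\<close> by (intro member_le_sum) auto
        hence "\<bar>norm (\<Sum>j<l. a j *\<^sub>R Z i (s j)) - p i (trunc l a)\<bar> \<le> \<epsilon>"
          using N i plegma_family_mono[OF s(1) L(2)[OF i]] s(2) a by simp
        thus "norm (\<Sum>j<l. a j *\<^sub>R Z i (s j)) \<le> p i (trunc l a) + \<epsilon>" by linarith
      qed
      have "norm (\<Sum>j<l. a j *\<^sub>R E j) \<le> (\<Sum>j<l. \<bar>a j\<bar>) * (D / (real N1 + 1))"
        by (rule norm_sum_scaleR_le) (rule err)
      also have "\<dots> \<le> real l * (D / (real N1 + 1))"
        using a \<open>D \<ge> 0\<close> sum_bounded_above[of "{..<l}" "\<lambda>j. \<bar>a j\<bar>" 1] by (intro mult_right_mono) auto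
      also have "\<dots> \<le> \<epsilon>"
      proof -
        have "real l * D \<le> \<epsilon> * real N1" using N1 \<epsilon> by (simp add: field_simps)
        also have "\<dots> \<le> \<epsilon> * (real N1 + 1)" using \<epsilon> by simp
        finally show ?thesis by (simp add: pos_divide_le_eq)
      qed
      finally show "norm (\<Sum>j<l. a j *\<^sub>R E j) \<le> \<epsilon>" .
    qed
    finally have "p\<^sub>0 (trunc l a) \<le> (\<Sum>i\<in>I. p i (trunc l a)) + (2 + real (card I)) * \<epsilon>"
      by (simp add: sum.distrib algebra_simps)
    thus ?thesis using c[where l = l and a = a] by linarith
  qed
  note bound = this
  show "c * (\<Sum>j<l. \<bar>a j\<bar>) \<le> (\<Sum>i\<in>I. p i (trunc l a))"
  proof (rule field_le_epsilon)
    fix e :: real assume "e > 0"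
    thus "c * (\<Sum>j<l. \<bar>a j\<bar>) \<le> (\<Sum>i\<in>I. p i (trunc l a)) + e"
      using bound[of "e / (2 + real (card I))"] by (simp add: add_pos_nonneg)
  qed
qed

text \<open>Combinations of a constant k-sequence with coefficient sum zero vanish; this is what
  excludes the constant component at the end.\<close>

lemma const_k_spreading_model_sum_zero:
  assumes "k_spreading_model k z M p" "k \<ge> 1" "\<And>s. z s = u" "m \<ge> 1"
    "\<forall>j<m. \<bar>a j\<bar> \<le> 1" "(\<Sum>j<m. a j) = 0"
  shows "p (trunc m a) \<le> 0"
proof (rule field_le_epsilon)
  fix e :: real assume "e > 0"
  obtain N where N: "\<forall>s a. plegma_family k M m s \<longrightarrow> N \<le> elt (s 0) 0 \<longrightarrow> (\<forall>j<m. \<bar>a j\<bar> \<le> 1) \<longrightarrow>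
     \<bar>norm (\<Sum>j<m. a j *\<^sub>R z (s j)) - p (trunc m a)\<bar> \<le> e"
    using k_spreading_model_eventually[OF assms(1,4) \<open>e > 0\<close>] by blast
  have "infinite M" using assms(1) by (simp add: k_spreading_model_def)
  then obtain s where "plegma_family k M m s" "N \<le> elt (s 0) 0"
    using ex_plegma_family assms(2,4) by blast
  with N assms(5) have "\<bar>norm (\<Sum>j<m. a j *\<^sub>R z (s j)) - p (trunc m a)\<bar> \<le> e" by blast
  moreover have "(\<Sum>j<m. a j *\<^sub>R z (s j)) = 0"
    using assms(6) by (simp add: assms(3) scaleR_sum_left[symmetric])
  ultimately show "p (trunc m a) \<le> 0 + e" by simp
qed

section \<open>Dilation: replacing points by groups of m consecutive points\<close>

lemma dilate_less:
  fixes r r' :: nat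
  assumes "r < r'" "j < m"
  shows "Suc r * m + j < Suc r' * m + j'"
proof -
  have "Suc r * m + j < Suc (Suc r) * m" using assms by simp
  also have "\<dots> \<le> Suc r' * m" using assms by (intro mult_right_mono) auto
  finally show ?thesis by simp
qed

lemma strict_mono_dilate:
  assumes "strict_mono (\<theta> :: nat \<Rightarrow> nat)" "j < m"
  shows "strict_mono (\<lambda>r. \<theta> (Suc r * m + j))"
  unfolding strict_mono_def
  using assms dilate_less strict_monoD[OF assms(1)] by blast

lemma elt_dilate:
  assumes "strict_mono (\<theta> :: nat \<Rightarrow> nat)" "j < m" "s \<in> ksubsets N k" "i < k"
  shows "elt ((\<lambda>r. \<theta> (Suc r * m + j)) ` s) i = \<theta> (Suc (elt s i) * m + j)"
  using assms strict_mono_dilate[OF assms(1,2)]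
  by (intro elt_image) (auto simp: ksubsets_def strict_mono_def strict_mono_on_def)

lemma dilate_ksubsets:
  assumes "strict_mono (\<theta> :: nat \<Rightarrow> nat)" "j < m" "s \<in> ksubsets N k" "range \<theta> \<subseteq> M"
  shows "(\<lambda>r. \<theta> (Suc r * m + j)) ` s \<in> ksubsets M k"
  using assms strict_mono_imp_inj_on[OF strict_mono_dilate[OF assms(1,2)]]
  by (auto simp: ksubsets_def intro!: card_image intro: inj_on_subset)

text \<open>Picking the j-th point in the group of every element gives m copies of each set. With j
  running fastest, the l*m copies are again plegma, because the groups of distinct elements do not
  overlap.\<close>

lemma plegma_family_dilate:
  assumes \<theta>: "strict_mono (\<theta> :: nat \<Rightarrow> nat)" "range \<theta> \<subseteq> M"
    and s: "plegma_family k N l s" and "l \<ge> 1" "m \<ge> 1"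
  shows "plegma_family k M (l * m) (\<lambda>n. (\<lambda>r. \<theta> (Suc r * m + n mod m)) ` s (n div m))"
proof -
  have div: "n div m < l" if "n < l * m" for n using that by (simp add: less_mult_imp_div_less)
  have md: "n mod m < m" for n using \<open>m \<ge> 1\<close> by simp
  have ks: "s (n div m) \<in> ksubsets N k" if "n < l * m" for n
    using plegma_family_ksubsets[OF s div[OF that]] .
  have elt: "elt ((\<lambda>r. \<theta> (Suc r * m + n mod m)) ` s (n div m)) i = \<theta> (Suc (elt (s (n div m)) i) * m + n mod m)"
    if "n < l * m" "i < k" for n i
    by (rule elt_dilate[OF \<theta>(1) md ks[OF that(1)] that(2)])
  have pos: "0 < l * m" using assms by simp
  show ?thesis
    unfolding plegma_family_def
  proof (intro conjI allI impI)
    show "(\<lambda>r. \<theta> (Suc r * m + n mod m)) ` s (n div m) \<in> ksubsets M k" if "n < l * m" for n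
      by (rule dilate_ksubsets[OF \<theta>(1) md ks[OF that] \<theta>(2)])
  next
    fix i n assume i: "i < k" and n: "n + 1 < l * m"
    have "Suc (elt (s (n div m)) i) * m + n mod m < Suc (elt (s ((n + 1) div m)) i) * m + (n + 1) mod m"
    \<comment> \<open>Either the last copy of one set is followed by the first copy of the next set,
      or both are copies of the same set.\<close>
    proof (cases "Suc (n mod m) = m")
      case True
      hence "(n + 1) div m = Suc (n div m)" by (simp add: div_Suc mod_Suc)
      moreover from this have "elt (s (n div m)) i < elt (s (Suc (n div m))) i"
        using i div[OF n] by (intro plegma_family_less[OF s]) auto
      ultimately show ?thesis using dilate_less[OF _ md] by simp
    next
      case False
      thus ?thesis by (simp add: div_Suc mod_Suc)
    qed
    thus "elt ((\<lambda>r. \<theta> (Suc r * m + n mod m)) ` s (n div m)) i <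
        elt ((\<lambda>r. \<theta> (Suc r * m + (n + 1) mod m)) ` s ((n + 1) div m)) i"
      using i n by (subst (1 2) elt) (auto intro: strict_monoD[OF \<theta>(1)])
  next
    fix i assume i: "i + 1 < k"
    have "elt (s ((l * m - 1) div m)) i \<le> elt (s (l - 1)) i"
      using i div[of "l * m - 1"] pos \<open>l \<ge> 1\<close> by (intro plegma_family_le[OF s]) auto
    also have "\<dots> < elt (s 0) (i + 1)" using s i unfolding plegma_family_def by blast
    finally have "Suc (elt (s ((l * m - 1) div m)) i) * m + (l * m - 1) mod m <
        Suc (elt (s (0 div m)) (i + 1)) * m + 0 mod m"
      using dilate_less[OF _ md, of _ _ "l * m - 1" 0] by simp
    thus "elt ((\<lambda>r. \<theta> (Suc r * m + (l * m - 1) mod m)) ` s ((l * m - 1) div m)) i <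
        elt ((\<lambda>r. \<theta> (Suc r * m + 0 mod m)) ` s (0 div m)) (i + 1)"
      using i pos by (subst (1 2) elt) (auto intro: strict_monoD[OF \<theta>(1)])
  qed
qed

(* The dilation starts at Suc r rather than r so that a family starting at the l-th element is sent
   past the (l * m)-th element of M. *)
lemma k_spreading_model_tens:
  fixes z :: "nat set \<Rightarrow> 'a::real_normed_vector"
  assumes "k_spreading_model k z M p" "k \<ge> 1" "m \<ge> 1" "\<And>j. j < m \<Longrightarrow> \<bar>a j\<bar> \<le> 1"
  shows "k_spreading_model k
     (\<lambda>s. \<Sum>j<m. a j *\<^sub>R z ((\<lambda>r. enumerate M (Suc r * m + j)) ` s)) UNIV (\<lambda>b. p (tens m a b))"
proof -
  have M: "infinite M" and semi: "fs_seminorm p"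
    using assms(1) by (auto simp: k_spreading_model_def)
  obtain \<delta> :: "nat \<Rightarrow> real" where \<delta>: "\<forall>l. \<delta> l > 0" "\<delta> \<longlonglongrightarrow> 0"
    "\<And>l m s a. 1 \<le> l \<Longrightarrow> 1 \<le> m \<Longrightarrow> m \<le> l \<Longrightarrow> plegma_family k M m s \<Longrightarrow>
          elt (s 0) 0 \<ge> enumerate M (l - 1) \<Longrightarrow> (\<forall>j<m. \<bar>a j\<bar> \<le> 1) \<Longrightarrow>
          \<bar>norm (\<Sum>j<m. a j *\<^sub>R z (s j)) - p (trunc m a)\<bar> \<le> \<delta> l"
    by (rule k_spreading_modelE[OF assms(1)]) (rule that)
  define \<theta> where "\<theta> = enumerate M"
  have \<theta>: "strict_mono \<theta>" "range \<theta> \<subseteq> M"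
    unfolding \<theta>_def strict_mono_def using M enumerate_in_set by auto
  have main: "\<bar>norm (\<Sum>q<l'. c q *\<^sub>R (\<Sum>j<m. a j *\<^sub>R z ((\<lambda>r. \<theta> (Suc r * m + j)) ` s q))) -
      p (tens m a (trunc l' c))\<bar> \<le> \<delta> (l * m)"
    if l: "1 \<le> l" "1 \<le> l'" "l' \<le> l" and s: "plegma_family k UNIV l' s"
      and first: "enumerate UNIV (l - 1) \<le> elt (s 0) 0" and c: "\<forall>q<l'. \<bar>c q\<bar> \<le> 1" for l l' s c
  proof -
    define S where "S = (\<lambda>n. (\<lambda>r. \<theta> (Suc r * m + n mod m)) ` s (n div m))"
    have S: "plegma_family k M (l' * m) S"
      unfolding S_def by (rule plegma_family_dilate[OF \<theta> s l(2) assms(3)])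
    have "S 0 = (\<lambda>r. \<theta> (Suc r * m + 0)) ` s 0" by (simp add: S_def)
    hence "elt (S 0) 0 = \<theta> (Suc (elt (s 0) 0) * m + 0)"
      using elt_dilate[OF \<theta>(1), of 0 m "s 0" UNIV k 0] plegma_family_ksubsets[OF s, of 0] l assms
      by auto
    moreover have "l * m - 1 \<le> Suc (elt (s 0) 0) * m + 0"
    proof -
      have "l - 1 \<le> elt (s 0) 0"
        using first le_enumerate[of "UNIV :: nat set" "l - 1"] by simp
      hence "l * m \<le> Suc (elt (s 0) 0) * m" by (intro mult_right_mono) auto
      thus ?thesis by simp
    qed
    ultimately have first': "enumerate M (l * m - 1) \<le> elt (S 0) 0"
      using strict_mono_less_eq[OF \<theta>(1)] unfolding \<theta>_def by simp
    have "\<forall>n<l' * m. \<bar>tens m a c n\<bar> \<le> 1"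
    proof (intro allI impI)
      fix n assume "n < l' * m"
      hence "n div m < l'" by (simp add: less_mult_imp_div_less)
      hence "\<bar>c (n div m)\<bar> * \<bar>a (n mod m)\<bar> \<le> 1 * 1" using c assms(3,4) by (intro mult_mono) auto
      thus "\<bar>tens m a c n\<bar> \<le> 1" by (simp add: tens_def abs_mult)
    qed
    hence "\<bar>norm (\<Sum>n<l' * m. tens m a c n *\<^sub>R z (S n)) - p (trunc (l' * m) (tens m a c))\<bar> \<le> \<delta> (l * m)"
      using l assms(3) by (intro \<delta>(3) S first') auto
    moreover have "(\<Sum>n<l' * m. tens m a c n *\<^sub>R z (S n)) =
       (\<Sum>q<l'. c q *\<^sub>R (\<Sum>j<m. a j *\<^sub>R z ((\<lambda>r. \<theta> (Suc r * m + j)) ` s q)))"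
      unfolding S_def by (rule sum_tens_scaleR)
    ultimately show ?thesis by (simp add: tens_trunc[OF assms(3)])
  qed
  \<comment> \<open>Families of length l' \<le> l turn into families of length l'*m \<le> l*m, so
    the new error sequence is a subsequence of \<delta>.\<close>
  have "filterlim (\<lambda>l. l * m) at_top sequentially"
    using assms(3) by (intro filterlim_subseq) (simp add: strict_mono_def)
  hence "(\<lambda>l. \<delta> (l * m)) \<longlonglongrightarrow> 0" by (rule filterlim_compose[OF \<delta>(2)])
  thus ?thesis
    unfolding k_spreading_model_def
    using fs_seminorm_tens[OF semi assms(3)] \<delta>(1) main unfolding \<theta>_def
    by (intro conjI exI[of _ "\<lambda>l. \<delta> (l * m)"]) auto
qed

lemma basis_coeff_sum:
  assumes "schauder_basis b"
  shows "basis_coeff b (\<Sum>j<(m::nat). a j *\<^sub>R y j) c = (\<Sum>j<m. a j * basis_coeff b (y j) c)"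
proof (induction m)
  case 0
  show ?case using basis_coeff_scaleR[OF assms, of 0 0 c] by simp
qed (simp add: basis_coeff_add[OF assms] basis_coeff_scaleR[OF assms])

text \<open>The interval assigned to a set depends on its i-th element alone. In a plegma pair the
  i-th elements are ordered, so all groups met by \<open>s1\<close> at level i precede those met by
  \<open>s2\<close>, and \<open>B\<close> turns this into an order of intervals.\<close>

lemma plegma_block_dilate:
  assumes basis: "schauder_basis b" and "i < k" "m \<ge> 1" "mono B" "strict_mono (\<theta> :: nat \<Rightarrow> nat)"
    and supp: "\<And>s. s \<in> ksubsets UNIV k \<Longrightarrow>
        basis_supp b (z s) \<subseteq> {B (elt s i)..<B (Suc (elt s i))}"
  shows "plegma_block b k (\<lambda>s. \<Sum>j<m. a j *\<^sub>R z ((\<lambda>r. \<theta> (Suc r * m + j)) ` s))"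
proof -
  define W where "W = (\<lambda>s. \<Sum>j<m. a j *\<^sub>R z ((\<lambda>r. \<theta> (Suc r * m + j)) ` s))"
  have loc: "\<exists>j<m. B (\<theta> (Suc (elt s i) * m + j)) \<le> n \<and> n < B (Suc (\<theta> (Suc (elt s i) * m + j)))"
    if s: "s \<in> ksubsets UNIV k" and n: "n \<in> basis_supp b (W s)" for s n
  proof -
    have "(\<Sum>j<m. a j * basis_coeff b (z ((\<lambda>r. \<theta> (Suc r * m + j)) ` s)) n) \<noteq> 0"
      using n by (simp add: basis_supp_def W_def basis_coeff_sum[OF basis])
    then obtain j where j: "j < m" "basis_coeff b (z ((\<lambda>r. \<theta> (Suc r * m + j)) ` s)) n \<noteq> 0"
      by (rule sum.not_neutral_contains_not_neutral) auto
    have "(\<lambda>r. \<theta> (Suc r * m + j)) ` s \<in> ksubsets UNIV k"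
      by (rule dilate_ksubsets[OF assms(5) j(1) s]) simp
    from supp[OF this] j(2)
    have "n \<in> {B (\<theta> (Suc (elt s i) * m + j))..<B (Suc (\<theta> (Suc (elt s i) * m + j)))}"
      unfolding elt_dilate[OF assms(5) j(1) s assms(2)] by (auto simp: basis_supp_def)
    thus ?thesis using j(1) by auto
  qed
  have "finite (basis_supp b (W s))" if s: "s \<in> ksubsets UNIV k" for s
  proof (rule finite_subset)
    show "basis_supp b (W s) \<subseteq> (\<Union>j<m. {..<B (Suc (\<theta> (Suc (elt s i) * m + j)))})"
      using loc[OF s] by auto
  qed auto
  moreover have "n < n'"
    if pair: "plegma_pair k UNIV s1 s2" and n: "n \<in> basis_supp b (W s1)" and n': "n' \<in> basis_supp b (W s2)"
    for s1 s2 n n'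
  proof -
    note fam = pair[unfolded plegma_pair_def]
    have ks: "s1 \<in> ksubsets UNIV k" "s2 \<in> ksubsets UNIV k"
      using plegma_family_ksubsets[OF fam, of 0] plegma_family_ksubsets[OF fam, of 1] by auto
    have less: "elt s1 i < elt s2 i"
      using plegma_family_less[OF fam assms(2), of 0 1] by simp
    obtain j where j: "j < m" "n < B (Suc (\<theta> (Suc (elt s1 i) * m + j)))"
      using loc[OF ks(1) n] by blast
    obtain j' where j': "j' < m" "B (\<theta> (Suc (elt s2 i) * m + j')) \<le> n'"
      using loc[OF ks(2) n'] by blast
    have "Suc (\<theta> (Suc (elt s1 i) * m + j)) \<le> \<theta> (Suc (elt s2 i) * m + j')"
      using strict_monoD[OF assms(5) dilate_less[OF less j(1), of j']] by simp
    hence "B (Suc (\<theta> (Suc (elt s1 i) * m + j))) \<le> B (\<theta> (Suc (elt s2 i) * m + j'))"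
      using assms(4) by (rule monoD[rotated])
    thus ?thesis using j j' by linarith
  qed
  ultimately show ?thesis unfolding plegma_block_def W_def[symmetric] by blast
qed

theorem mainTheorem11:
  fixes b :: "nat \<Rightarrow> 'a::banach" and k :: nat
  assumes "schauder_basis b"
    and "k \<ge> 1"
    and "\<exists>(x :: nat set \<Rightarrow> 'a) M p.
           weakly_rel_compact (x ` ksubsets UNIV k) \<and> k_spreading_model k x M p \<and> equiv_l1 p"
  shows "\<exists>(x :: nat set \<Rightarrow> 'a). plegma_block b k x \<and>
           (\<exists>M p. k_spreading_model k x M p \<and> equiv_l1 p)"
proof -
  obtain x :: "nat set \<Rightarrow> 'a" and M\<^sub>0 p\<^sub>0 where wrc: "weakly_rel_compact (x ` ksubsets UNIV k)"
    and x: "k_spreading_model k x M\<^sub>0 p\<^sub>0" and "equiv_l1 p\<^sub>0"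
    using assms(3) by blast
  from \<open>equiv_l1 p\<^sub>0\<close> obtain c where c: "c > 0" "\<And>l a. c * (\<Sum>j<l. \<bar>a j\<bar>) \<le> p\<^sub>0 (trunc l a)"
    unfolding equiv_l1_def by blast
  obtain \<nu> B :: "nat \<Rightarrow> nat" and Z :: "nat \<Rightarrow> nat set \<Rightarrow> 'a" and u R where
    \<nu>: "strict_mono \<nu>" "range \<nu> \<subseteq> M\<^sub>0" and B: "mono B"
    and bound: "\<And>i s. i \<le> k \<Longrightarrow> s \<in> ksubsets UNIV k \<Longrightarrow> norm (Z i s) \<le> R"
    and Zk: "\<And>s. Z k s = u"
    and supp: "\<And>i s. i < k \<Longrightarrow> s \<in> ksubsets UNIV k \<Longrightarrow>
        basis_supp b (Z i s) \<subseteq> {B (elt s i)..<B (Suc (elt s i))}"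
    and approx: "\<And>s. s \<in> ksubsets UNIV k \<Longrightarrow>
        norm (x (\<nu> ` s) - (\<Sum>i\<le>k. Z i s)) \<le> 2 * real k / (real (elt s 0) + 1)"
    by (rule plegma_block_decomposition[OF assms(1,2) wrc x]) (rule that)
  \<comment> \<open>Asking for a model along some set containing \<open>L\<close> makes the property
    hereditary in \<open>L\<close> at once.\<close>
  have "\<exists>L\<subseteq>UNIV. infinite L \<and> (\<forall>i\<in>{..k}. \<exists>M p. L \<subseteq> M \<and> k_spreading_model k (Z i) M p)"
  proof (rule finite_hereditary_subset)
    show "\<exists>L\<subseteq>N. infinite L \<and> (\<exists>M p. L \<subseteq> M \<and> k_spreading_model k (Z i) M p)"
      if i: "i \<in> {..k}" and N: "infinite N" for i N
    proof -
      have "\<exists>L\<subseteq>N. infinite L \<and> (\<exists>p. k_spreading_model k (Z i) L p)"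
        using i by (intro bounded_imp_k_spreading_model[OF assms(2) N, where B = R] bound)
          (auto simp: ksubsets_def)
      then obtain L p where "L \<subseteq> N" "infinite L" "k_spreading_model k (Z i) L p" by blast
      thus ?thesis by (intro exI[of _ L] exI[of _ p] conjI) auto
    qed
    show "\<exists>M p. L' \<subseteq> M \<and> k_spreading_model k (Z i) M p"
      if "\<exists>M p. L \<subseteq> M \<and> k_spreading_model k (Z i) M p" "L' \<subseteq> L" for i L L'
      using that by (meson order_trans)
  qed auto
  then obtain L where L: "infinite L" "\<forall>i\<in>{..k}. \<exists>M p. L \<subseteq> M \<and> k_spreading_model k (Z i) M p" by blast
  from bchoice[OF L(2)] obtain M where "\<forall>i\<in>{..k}. \<exists>p. L \<subseteq> M i \<and> k_spreading_model k (Z i) (M i) p"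
    by blast
  from bchoice[OF this] obtain p where LM: "\<And>i. i \<in> {..k} \<Longrightarrow> L \<subseteq> M i"
    and p: "\<And>i. i \<in> {..k} \<Longrightarrow> k_spreading_model k (Z i) (M i) (p i)"
    by blast
  have low: "c * (\<Sum>j<l. \<bar>a j\<bar>) \<le> (\<Sum>i\<le>k. p i (trunc l a))" for l a
  proof (rule sum_k_spreading_models_l1_lower_bound[OF assms(2) _ x c(2) \<nu> p L(1) LM, where D = "2 * real k"])
    show "norm (x (\<nu> ` s) - (\<Sum>i\<le>k. Z i s)) \<le> 2 * real k / (real (elt s 0) + 1)"
      if "s \<in> ksubsets L k" for s
      using that by (intro approx) (simp add: ksubsets_def)
  qed auto
  have semi: "fs_seminorm (p i)" and inv: "shift_invariant (p i)" if "i \<in> {..k}" for i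
    using p[OF that] k_spreading_model_shift_invariant[OF p[OF that] assms(2)]
    by (auto simp: k_spreading_model_def)
  obtain i m a c' where i: "i \<le> k" and m: "m \<ge> 1" and a: "(\<Sum>j<m. \<bar>a j\<bar>) = 1" and "c' > 0"
    and c': "\<And>l d. c' * (\<Sum>j<l. \<bar>d j\<bar>) \<le> p i (tens m a (trunc l d))"
    using exists_tens_l1[OF finite_atMost c(1) semi inv low] by auto
  have a1: "\<bar>a j\<bar> \<le> 1" if "j < m" for j
    using member_le_sum[of j "{..<m}" "\<lambda>j. \<bar>a j\<bar>"] that a by auto
  have "i \<noteq> k"
  proof
    assume ik: "i = k"
    \<comment> \<open>The difference of two consecutive translates of \<open>a\<close> has
      coefficient sum zero, so the constant component vanishes on it, while the lower estimate
      demands at least 2 c'.\<close>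
    define d :: "nat \<Rightarrow> real" where "d = (\<lambda>q. if q = 0 then 1 else -1)"
    have "\<forall>n<2 * m. \<bar>tens m a d n\<bar> \<le> 1"
      using a1 m by (auto simp: tens_def d_def)
    moreover have "(\<Sum>n<2 * m. tens m a d n) = 0"
      using sum_tens_scaleR[of m a d "\<lambda>_ _. 1::real" 2] by (simp add: d_def numeral_2_eq_2)
    moreover have "k_spreading_model k (Z k) (M k) (p k)" by (rule p) simp
    ultimately have "p k (trunc (2 * m) (tens m a d)) \<le> 0"
      using m by (intro const_k_spreading_model_sum_zero[OF _ assms(2) Zk]) auto
    moreover have "c' * (\<Sum>j<2. \<bar>d j\<bar>) \<le> p k (trunc (2 * m) (tens m a d))"
      using c'[where l = 2 and d = d] by (simp add: tens_trunc[OF m] ik)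
    ultimately show False using \<open>c' > 0\<close> by (simp add: d_def numeral_2_eq_2)
  qed
  hence ik: "i < k" "i \<in> {..k}" using i by auto
  have "infinite (M i)" using p[OF ik(2)] by (simp add: k_spreading_model_def)
  hence \<theta>: "strict_mono (enumerate (M i))" by (simp add: strict_mono_def)
  define W where "W = (\<lambda>s. \<Sum>j<m. a j *\<^sub>R Z i ((\<lambda>r. enumerate (M i) (Suc r * m + j)) ` s))"
  have "plegma_block b k W"
    unfolding W_def by (rule plegma_block_dilate[OF assms(1) ik(1) m B \<theta>]) (rule supp[OF ik(1)])
  moreover have "k_spreading_model k W UNIV (\<lambda>d. p i (tens m a d))"
    unfolding W_def by (rule k_spreading_model_tens[OF p[OF ik(2)] assms(2) m a1])
  \<comment> \<open>The upper constant is the seminorm of a single block.\<close>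
  moreover have "equiv_l1 (\<lambda>d. p i (tens m a d))"
    unfolding equiv_l1_def
    using \<open>c' > 0\<close> c' tens_upper_bound[OF semi[OF ik(2)] inv[OF ik(2)] m, of a]
    by (intro exI[of _ c'] exI[of _ "p i (trunc m a)"]) auto
  ultimately show ?thesis by blast
qed

end
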